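(* Let $r\neq s$ be positive integers, $n=2r+2s$, and let $T_{2,1}$ be the tree with passport $[r^2,s^2;4,1^{n-4};n]$ in which the degrees of the black vertices in cyclic order around the degree-$4$ white vertex are $(r,s,r,s)$. Then a Shabat polynomial of $T_{2,1}$ is $P=R\circ Q$, where $$R(x)=(-1)^r\left(\frac{r}{s}\right)^s(x-1)^r\left(x+\frac{s}{r}\right)^s,\qquad Q(x)=x^2 .$$
   Context: A Shabat polynomial is a complex polynomial with at most two finite critical values $c_1,c_2$. Its tree is the bicolored plane tree $P^{-1}([c_1,c_2])$, with black vertices the points of $P^{-1}(c_1)$, white vertices the points of $P^{-1}(c_2)$, edges the connected components of the preimage of the open segment $(c_1,c_2)$, and vertex degree equal to the multiplicity of the corresponding root of $P-c_1$ or $P-c_2$. The passport $[\alpha;\beta;n]$ of a tree with $n$ edges records the partition $\alpha\vdash n$ of black vertex degrees and $\beta\vdash n$ of white vertex degrees ($k^m$ means $k$ repeated $m$ times). In the claim, $c_1=0$ and $c_2=1$. *)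

theory Defs
  imports "HOL-Analysis.Analysis" "HOL-Computational_Algebra.Polynomial" "HOL-Library.Multiset"
begin

text \<open>
  \<open>rot T v e\<close> is the edge that follows \<open>e\<close> in counterclockwise order around the vertex \<open>v\<close>.
  The fields \<open>inc\<close> and \<open>rot\<close> are only meaningful for vertices \<open>v\<close> and edges \<open>e\<close> of \<open>T\<close>
  (for \<open>rot\<close>: for edges \<open>e\<close> incident with \<open>v\<close>).
\<close>

record ('v, 'e) bicolored_plane_graph =
  black :: "'v set"
  white :: "'v set"
  edges :: "'e set"
  inc :: "'v \<Rightarrow> 'e \<Rightarrow> bool"
  rot :: "'v \<Rightarrow> 'e \<Rightarrow> 'e"

definition verts :: "('v, 'e) bicolored_plane_graph \<Rightarrow> 'v set" where
  "verts T = black T \<union> white T"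

definition edges_at :: "('v, 'e) bicolored_plane_graph \<Rightarrow> 'v \<Rightarrow> 'e set" where
  "edges_at T v = {e \<in> edges T. inc T v e}"

definition vdegree :: "('v, 'e) bicolored_plane_graph \<Rightarrow> 'v \<Rightarrow> nat" where
  "vdegree T v = card (edges_at T v)"

definition black_end :: "('v, 'e) bicolored_plane_graph \<Rightarrow> 'e \<Rightarrow> 'v" where
  "black_end T e = (THE b. b \<in> black T \<and> inc T b e)"

definition graph_connected :: "('v, 'e) bicolored_plane_graph \<Rightarrow> bool" where
  "graph_connected T \<longleftrightarrow> verts T \<noteq> {} \<and>
     (\<forall>u \<in> verts T. \<forall>v \<in> verts T.
        (u, v) \<in> {(x, y). x \<in> verts T \<and> y \<in> verts T \<and> (\<exists>e \<in> edges T. inc T x e \<and> inc T y e)}\<^sup>*)"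

text \<open>
  A cycle has distinct vertices \<open>vs\<close> and distinct edges \<open>es\<close>, with \<open>es ! i\<close> joining \<open>vs ! i\<close> to
  its cyclic successor; length two is a pair of parallel edges.
\<close>

definition graph_cycle :: "('v, 'e) bicolored_plane_graph \<Rightarrow> 'v list \<Rightarrow> 'e list \<Rightarrow> bool" where
  "graph_cycle T vs es \<longleftrightarrow>
     length vs = length es \<and> 2 \<le> length es \<and> distinct vs \<and> distinct es \<and>
     set vs \<subseteq> verts T \<and> set es \<subseteq> edges T \<and>
     (\<forall>i < length es. inc T (vs ! i) (es ! i) \<and> inc T (vs ! (Suc i mod length es)) (es ! i))"

definition bicolored_plane_tree :: "('v, 'e) bicolored_plane_graph \<Rightarrow> bool" where
  "bicolored_plane_tree T \<longleftrightarrow>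
     finite (verts T) \<and> finite (edges T) \<and> black T \<inter> white T = {} \<and>
     (\<forall>e \<in> edges T. (\<exists>!b. b \<in> black T \<and> inc T b e) \<and> (\<exists>!w. w \<in> white T \<and> inc T w e)) \<and>
     graph_connected T \<and> (\<nexists>vs es. graph_cycle T vs es) \<and>
     (\<forall>v \<in> verts T. \<forall>e \<in> edges_at T v.
        rot T v e \<in> edges_at T v \<and> (\<forall>f \<in> edges_at T v. \<exists>k. (rot T v ^^ k) e = f))"

definition passport :: "('v, 'e) bicolored_plane_graph \<Rightarrow> nat multiset \<times> nat multiset \<times> nat" where
  "passport T = (image_mset (vdegree T) (mset_set (black T)),
                 image_mset (vdegree T) (mset_set (white T)),
                 card (edges T))"

text \<open>The degrees of the black neighbours of \<open>w\<close>, counterclockwise, starting at the edge \<open>e\<close>.\<close>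

definition black_degrees_around ::
    "('v, 'e) bicolored_plane_graph \<Rightarrow> 'v \<Rightarrow> 'e \<Rightarrow> nat list" where
  "black_degrees_around T w e =
     map (\<lambda>i. vdegree T (black_end T ((rot T w ^^ i) e))) [0..<vdegree T w]"

definition plane_graph_iso ::
    "('v, 'e) bicolored_plane_graph \<Rightarrow> ('w, 'f) bicolored_plane_graph \<Rightarrow> bool" where
  "plane_graph_iso S T \<longleftrightarrow>
     (\<exists>\<phi> \<psi>. bij_betw \<phi> (verts S) (verts T) \<and> \<phi> ` black S = black T \<and> \<phi> ` white S = white T \<and>
        bij_betw \<psi> (edges S) (edges T) \<and>
        (\<forall>v \<in> verts S. \<forall>e \<in> edges S. inc S v e \<longleftrightarrow> inc T (\<phi> v) (\<psi> e)) \<and>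
        (\<forall>v \<in> verts S. \<forall>e \<in> edges_at S v. \<psi> (rot S v e) = rot T (\<phi> v) (\<psi> e)))"

definition critical_values :: "complex poly \<Rightarrow> complex set" where
  "critical_values p = poly p ` {z. poly (pderiv p) z = 0}"

definition shabat_polynomial :: "complex \<Rightarrow> complex \<Rightarrow> complex poly \<Rightarrow> bool" where
  "shabat_polynomial c1 c2 p \<longleftrightarrow> c1 \<noteq> c2 \<and> degree p > 0 \<and> critical_values p \<subseteq> {c1, c2}"

definition tangent_direction :: "complex \<Rightarrow> complex set \<Rightarrow> complex" where
  "tangent_direction v e = Lim (at v within e) (\<lambda>z. sgn (z - v))"

text \<open>
  The counterclockwise angle from direction \<open>a\<close> to direction \<open>b\<close>, taken in \<open>(0, 2 * pi]\<close>, so that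
  an edge comes last in the order that starts at itself and a sole edge at a vertex is its own
  successor.
\<close>

definition ccw_angle :: "complex \<Rightarrow> complex \<Rightarrow> real" where
  "ccw_angle a b = (if Arg2pi (b / a) = 0 then 2 * pi else Arg2pi (b / a))"

text \<open>
  The preimage of the segment from \<open>c1\<close> to \<open>c2\<close> with the plane structure inherited from the complex
  plane. At a vertex of multiplicity \<open>k\<close> (as a root of \<open>p - c1\<close> or \<open>p - c2\<close>) exactly \<open>k\<close> edges
  meet, and their tangent directions are equally spaced; hence the graph degree is the multiplicity
  and the tangents determine the cyclic order.
\<close>

definition shabat_tree ::
    "complex \<Rightarrow> complex \<Rightarrow> complex poly \<Rightarrow> (complex, complex set) bicolored_plane_graph" where
  "shabat_tree c1 c2 p =
     (let E = components {z. poly p z \<in> open_segment c1 c2} in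
      \<lparr> black = {z. poly p z = c1},
        white = {z. poly p z = c2},
        edges = E,
        inc = (\<lambda>v e. v \<in> closure e),
        rot = (\<lambda>v e. arg_min_on
                 (\<lambda>f. ccw_angle (tangent_direction v e) (tangent_direction v f))
                 {f \<in> E. v \<in> closure f}) \<rparr>)"

definition shabat_polynomial_of ::
    "complex \<Rightarrow> complex \<Rightarrow> complex poly \<Rightarrow> ('v, 'e) bicolored_plane_graph \<Rightarrow> bool" where
  "shabat_polynomial_of c1 c2 p T \<longleftrightarrow>
     shabat_polynomial c1 c2 p \<and> plane_graph_iso (shabat_tree c1 c2 p) T"

end

theory Submission
  imports Defs
    "HOL-Complex_Analysis.Conformal_Mappings"
    "HOL-Computational_Algebra.Fundamental_Theorem_Algebra"
    "HOL-Real_Asymp.Real_Asymp"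
begin

text \<open>
  Away from its critical values a polynomial is a covering map, so \<open>P\<close> maps every component of
  the preimage of the open segment from 0 to 1 bijectively onto the segment. Near a root of
  multiplicity \<open>k\<close> of \<open>P\<close> or of \<open>1 - P\<close> the polynomial is the \<open>k\<close>-th power of a local
  coordinate, which gives \<open>k\<close> equally spaced rays, one in each edge at the root. Hence the preimage
  is a plane graph whose degrees are the multiplicities. For the given \<open>P\<close> the origin is a white
  vertex of degree 4, and the segments from it to the roots of \<open>P\<close>, which lie on the two axes, run
  inside its four edges.

  On the combinatorial side, a plane graph in which every black vertex is joined to the white
  vertex \<open>w\<close> by one edge and the other white vertices are leaves is determined by the degrees of the
  black vertices in the cyclic order around \<open>w\<close>: starting from an edge at \<open>w\<close>, turn \<open>i\<close> times
  around \<open>w\<close> and then \<open>k\<close> times around the black end; the pair \<open>(i, k)\<close> is a coordinate on the edges.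
\<close>

subsection \<open>Plane graphs and rotations\<close>

definition white_end :: "('v, 'e) bicolored_plane_graph \<Rightarrow> 'e \<Rightarrow> 'v" where
  "white_end T e = (THE w. w \<in> white T \<and> inc T w e)"

text \<open>The local part of the tree axioms, together with at least one edge at every vertex. It
  can be checked for the preimage of the segment vertex by vertex, without a global argument about
  connectedness or cycles, and it lets every vertex be recovered from the edges at it.\<close>

definition plane_graph :: "('v, 'e) bicolored_plane_graph \<Rightarrow> bool" where
  "plane_graph T \<longleftrightarrow>
     black T \<inter> white T = {} \<and>
     (\<forall>e \<in> edges T. (\<exists>!b. b \<in> black T \<and> inc T b e) \<and> (\<exists>!w. w \<in> white T \<and> inc T w e)) \<and>
     (\<forall>v \<in> verts T. finite (edges_at T v) \<and> edges_at T v \<noteq> {} \<and>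
        (\<forall>e \<in> edges_at T v. rot T v e \<in> edges_at T v \<and>
           (\<forall>f \<in> edges_at T v. \<exists>k. (rot T v ^^ k) e = f)))"

definition centered :: "('v, 'e) bicolored_plane_graph \<Rightarrow> 'v \<Rightarrow> bool" where
  "centered T w \<longleftrightarrow>
     plane_graph T \<and> w \<in> white T \<and> inj_on (black_end T) (edges_at T w) \<and>
     black_end T ` edges_at T w = black T \<and> (\<forall>u \<in> white T - {w}. vdegree T u = 1)"

definition spoke :: "('v, 'e) bicolored_plane_graph \<Rightarrow> 'v \<Rightarrow> 'e \<Rightarrow> nat \<Rightarrow> 'e" where
  "spoke T w e i = (rot T w ^^ i) e"

definition spoke_end :: "('v, 'e) bicolored_plane_graph \<Rightarrow> 'v \<Rightarrow> 'e \<Rightarrow> nat \<Rightarrow> 'v" where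
  "spoke_end T w e i = black_end T (spoke T w e i)"

definition edge_coord :: "('v, 'e) bicolored_plane_graph \<Rightarrow> 'v \<Rightarrow> 'e \<Rightarrow> nat \<times> nat \<Rightarrow> 'e" where
  "edge_coord T w e = (\<lambda>(i, k). (rot T (spoke_end T w e i) ^^ k) (spoke T w e i))"

section \<open>Orbits of a transitive self-map of a finite set\<close>

lemma funpow_in: "f ` A \<subseteq> A \<Longrightarrow> a \<in> A \<Longrightarrow> (f ^^ k) a \<in> A"
  by (induction k) auto

text \<open>Let \<open>m\<close> be the first return time of \<open>e\<close>. The iterates before
  time \<open>m\<close> are distinct by minimality and exhaust \<open>A\<close> by transitivity, so
  \<open>m = card A\<close>. Injectivity of \<open>f\<close> is not presupposed; that
  \<open>e\<close> returns at all follows from transitivity applied to \<open>f e\<close> and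
  \<open>e\<close>.\<close>

lemma transitive_orbit:
  assumes "finite A" "f ` A \<subseteq> A" "\<And>a b. a \<in> A \<Longrightarrow> b \<in> A \<Longrightarrow> \<exists>k. (f ^^ k) a = b" "e \<in> A"
  shows "bij_betw (\<lambda>k. (f ^^ k) e) {..<card A} A" "(f ^^ card A) e = e"
proof -
  have ex: "\<exists>k. 0 < k \<and> (f ^^ k) e = e"
  proof -
    have "f e \<in> A" using assms by auto
    then obtain k where "(f ^^ k) (f e) = e" using assms by blast
    then have "(f ^^ Suc k) e = e" by (simp add: funpow_swap1)
    then show ?thesis by blast
  qed
  define m where "m = (LEAST k. 0 < k \<and> (f ^^ k) e = e)"
  have m: "0 < m" "(f ^^ m) e = e" using LeastI_ex[OF ex] by (auto simp: m_def)
  have min: "\<not> (0 < k \<and> (f ^^ k) e = e)" if "k < m" for k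
    using not_less_Least that unfolding m_def by blast
  have inj: "inj_on (\<lambda>k. (f ^^ k) e) {..<m}"
  proof (rule linorder_inj_onI)
    fix i j assume ij: "i < j" "i \<in> {..<m}" "j \<in> {..<m}"
    show "(f ^^ i) e \<noteq> (f ^^ j) e"
    proof
      assume "(f ^^ i) e = (f ^^ j) e"
      \<comment> \<open>From a collision at times \<open>i < j\<close>, the remaining
        \<open>m - j\<close> steps lead back to \<open>e\<close>, so \<open>e\<close> would already
        return at time \<open>m - j + i < m\<close>.\<close>
      then have "(f ^^ (m - j)) ((f ^^ i) e) = (f ^^ (m - j)) ((f ^^ j) e)" by simp
      also have "\<dots> = (f ^^ (m - j + j)) e" by (simp only: funpow_add o_apply)
      also have "\<dots> = e" using ij m by simp
      finally have "(f ^^ (m - j + i)) e = e" by (simp add: funpow_add)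
      with min[of "m - j + i"] ij show False by auto
    qed
  qed auto
  have "(\<lambda>k. (f ^^ k) e) ` {..<m} = A"
  proof (intro subset_antisym subsetI)
    fix b assume "b \<in> A"
    then obtain k where "(f ^^ k) e = b" using assms by blast
    then have "(f ^^ (k mod m)) e = b" using funpow_mod_eq[OF m(2)] by metis
    then show "b \<in> (\<lambda>k. (f ^^ k) e) ` {..<m}" using m by force
  next
    fix b assume "b \<in> (\<lambda>k. (f ^^ k) e) ` {..<m}"
    then show "b \<in> A" using funpow_in[OF assms(2,4)] by auto
  qed
  then have "bij_betw (\<lambda>k. (f ^^ k) e) {..<m} A" using inj by (simp add: bij_betw_def)
  moreover from this have "m = card A" by (metis bij_betw_same_card card_lessThan)
  ultimately show "bij_betw (\<lambda>k. (f ^^ k) e) {..<card A} A" "(f ^^ card A) e = e" using m by auto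
qed

section \<open>Ends of edges, orbits of the rotation, and isomorphisms built from edge
  bijections\<close>

lemma plane_graphD:
  assumes "plane_graph T"
  shows "black T \<inter> white T = {}"
    "e \<in> edges T \<Longrightarrow> \<exists>!b. b \<in> black T \<and> inc T b e"
    "e \<in> edges T \<Longrightarrow> \<exists>!w. w \<in> white T \<and> inc T w e"
    "v \<in> verts T \<Longrightarrow> finite (edges_at T v)"
    "v \<in> verts T \<Longrightarrow> edges_at T v \<noteq> {}"
    "v \<in> verts T \<Longrightarrow> e \<in> edges_at T v \<Longrightarrow> rot T v e \<in> edges_at T v"
    "v \<in> verts T \<Longrightarrow> e \<in> edges_at T v \<Longrightarrow> f \<in> edges_at T v \<Longrightarrow> \<exists>k. (rot T v ^^ k) e = f"
  using assms unfolding plane_graph_def by blast+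

lemma edge_ends:
  assumes "plane_graph T" "e \<in> edges T"
  shows "black_end T e \<in> black T" "inc T (black_end T e) e"
    "white_end T e \<in> white T" "inc T (white_end T e) e"
  using theI'[OF plane_graphD(2)[OF assms]] theI'[OF plane_graphD(3)[OF assms]]
  by (auto simp: black_end_def white_end_def)

lemma inc_black_iff: "plane_graph T \<Longrightarrow> e \<in> edges T \<Longrightarrow> b \<in> black T \<Longrightarrow> inc T b e \<longleftrightarrow> black_end T e = b"
  using edge_ends[of T e] plane_graphD(2)[of T e] by auto

lemma inc_white_iff: "plane_graph T \<Longrightarrow> e \<in> edges T \<Longrightarrow> b \<in> white T \<Longrightarrow> inc T b e \<longleftrightarrow> white_end T e = b"
  using edge_ends[of T e] plane_graphD(3)[of T e] by auto

lemma edges_at_black: "plane_graph T \<Longrightarrow> b \<in> black T \<Longrightarrow> edges_at T b = {e \<in> edges T. black_end T e = b}"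
  by (auto simp: edges_at_def inc_black_iff)

lemma edges_at_white: "plane_graph T \<Longrightarrow> b \<in> white T \<Longrightarrow> edges_at T b = {e \<in> edges T. white_end T e = b}"
  by (auto simp: edges_at_def inc_white_iff)

lemma rot_orbit:
  assumes "plane_graph T" "v \<in> verts T" "e \<in> edges_at T v"
  shows "bij_betw (\<lambda>k. (rot T v ^^ k) e) {..<vdegree T v} (edges_at T v)"
    "(rot T v ^^ vdegree T v) e = e"
    "(rot T v ^^ k) e \<in> edges_at T v"
proof -
  note * = transitive_orbit[of "edges_at T v" "rot T v" e]
  show "bij_betw (\<lambda>k. (rot T v ^^ k) e) {..<vdegree T v} (edges_at T v)"
    "(rot T v ^^ vdegree T v) e = e"
    unfolding vdegree_def by (intro *; use plane_graphD(4,6,7)[OF assms(1,2)] assms(3) in blast)+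
  show "(rot T v ^^ k) e \<in> edges_at T v"
    by (rule funpow_in) (use plane_graphD(4,6,7)[OF assms(1,2)] assms(3) in blast)+
qed

text \<open>The vertices of one colour are the orbits of the rotation of the edges around their ends of
  that colour, so a bijection of edges that commutes with these rotations acts on them.\<close>

lemma orbit_map:
  assumes \<psi>: "bij_betw \<psi> E E'" and V: "V = b ` E" "V' = b' ` E'"
    and b: "\<And>e. e \<in> E \<Longrightarrow> \<rho> (b e) e \<in> E \<and> b (\<rho> (b e) e) = b e"
    and b': "\<And>e. e \<in> E' \<Longrightarrow> \<rho>' (b' e) e \<in> E' \<and> b' (\<rho>' (b' e) e) = b' e"
    and tr: "\<And>e f. e \<in> E \<Longrightarrow> f \<in> E \<Longrightarrow> b e = b f \<Longrightarrow> \<exists>k. (\<rho> (b e) ^^ k) e = f"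
    and tr': "\<And>e f. e \<in> E' \<Longrightarrow> f \<in> E' \<Longrightarrow> b' e = b' f \<Longrightarrow> \<exists>k. (\<rho>' (b' e) ^^ k) e = f"
    and com: "\<And>e. e \<in> E \<Longrightarrow> \<psi> (\<rho> (b e) e) = \<rho>' (b' (\<psi> e)) (\<psi> e)"
  shows "\<exists>\<phi>. bij_betw \<phi> V V' \<and> (\<forall>e \<in> E. \<phi> (b e) = b' (\<psi> e))"
proof -
  have \<psi>E: "\<psi> e \<in> E'" if "e \<in> E" for e using \<psi> that by (auto simp: bij_betw_def)
  \<comment> \<open>The commutation hypothesis moves one edge by the rotation at its own end. To
    iterate it, the induction must also carry that both ends stay fixed along the orbit.\<close>
  have pow: "(\<rho> (b e) ^^ k) e \<in> E \<and> b ((\<rho> (b e) ^^ k) e) = b e \<and>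
      b' ((\<rho>' (b' (\<psi> e)) ^^ k) (\<psi> e)) = b' (\<psi> e) \<and>
      \<psi> ((\<rho> (b e) ^^ k) e) = (\<rho>' (b' (\<psi> e)) ^^ k) (\<psi> e)" if e: "e \<in> E" for e k
  proof (induction k)
    case (Suc k)
    let ?f = "(\<rho> (b e) ^^ k) e"
    have f: "?f \<in> E" "b ?f = b e" "b' (\<psi> ?f) = b' (\<psi> e)"
        "\<psi> ?f = (\<rho>' (b' (\<psi> e)) ^^ k) (\<psi> e)" using Suc by auto
    show ?case using b[OF f(1)] com[OF f(1)] b'[OF \<psi>E[OF f(1)]] f by auto
  qed (use e in auto)
  have 1: "b' (\<psi> e) = b' (\<psi> f)" if "e \<in> E" "f \<in> E" "b e = b f" for e f
    using tr[OF that] pow[OF that(1)] by metis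
  have 2: "b e = b f" if ef: "e \<in> E" "f \<in> E" "b' (\<psi> e) = b' (\<psi> f)" for e f
  proof -
    obtain k where "(\<rho>' (b' (\<psi> e)) ^^ k) (\<psi> e) = \<psi> f" using tr'[OF \<psi>E[OF ef(1)] \<psi>E[OF ef(2)] ef(3)] by blast
    then have "\<psi> ((\<rho> (b e) ^^ k) e) = \<psi> f" using pow[OF ef(1), of k] by simp
    then have "(\<rho> (b e) ^^ k) e = f"
      using pow[OF ef(1), of k] ef(2) by (blast intro: inj_onD[OF bij_betw_imp_inj_on[OF \<psi>]])
    then show ?thesis using pow[OF ef(1), of k] by auto
  qed
  \<comment> \<open>The edge chosen at \<open>v\<close> does not matter: by \<open>1\<close>, edges
    with a common end have images with a common end. Injectivity of the resulting map is
    \<open>2\<close>.\<close>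
  define \<phi> where "\<phi> v = b' (\<psi> (SOME e. e \<in> E \<and> b e = v))" for v
  have \<phi>: "\<phi> (b e) = b' (\<psi> e)" if "e \<in> E" for e
  proof -
    have *: "(SOME f. f \<in> E \<and> b f = b e) \<in> E \<and> b (SOME f. f \<in> E \<and> b f = b e) = b e"
      by (rule someI[of _ e]) (use that in simp)
    show ?thesis unfolding \<phi>_def using 1 * that by blast
  qed
  have "bij_betw \<phi> V V'"
    unfolding bij_betw_def
  proof
    show "inj_on \<phi> V" unfolding V
    proof (rule inj_onI, elim imageE, hypsubst)
      fix e f assume "\<phi> (b e) = \<phi> (b f)" "e \<in> E" "f \<in> E"
      then show "b e = b f" using 2[of e f] \<phi>[of e] \<phi>[of f] by simp
    qed
    have "\<phi> ` V = b' ` \<psi> ` E" unfolding V image_image by (rule image_cong[OF refl \<phi>])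
    then show "\<phi> ` V = V'" unfolding V using \<psi> by (simp add: bij_betw_def)
  qed
  with \<phi> show ?thesis by blast
qed

text \<open>No vertex map has to be supplied: \<open>orbit_map\<close>, applied once per colour,
  produces it from \<open>\<psi>\<close>, and the two maps are glued because the colour classes are
  disjoint.\<close>

lemma plane_graph_isoI:
  assumes G: "plane_graph G" and H: "plane_graph H" and \<psi>: "bij_betw \<psi> (edges G) (edges H)"
    and bl: "\<And>e. e \<in> edges G \<Longrightarrow> \<psi> (rot G (black_end G e) e) = rot H (black_end H (\<psi> e)) (\<psi> e)"
    and wh: "\<And>e. e \<in> edges G \<Longrightarrow> \<psi> (rot G (white_end G e) e) = rot H (white_end H (\<psi> e)) (\<psi> e)"
  shows "plane_graph_iso G H"
proof -
  have \<psi>E: "\<psi> e \<in> edges H" if "e \<in> edges G" for e using \<psi> that by (auto simp: bij_betw_def)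
  \<comment> \<open>Since each vertex carries an edge, a colour class is the image of its end map,
    the form that \<open>orbit_map\<close> expects.\<close>
  have Vb: "black T = black_end T ` edges T" if T: "plane_graph T" for T :: "('x, 'y) bicolored_plane_graph"
  proof (intro subset_antisym subsetI)
    fix v assume v: "v \<in> black T"
    then obtain e where "e \<in> edges_at T v" using plane_graphD(5)[OF T, of v] by (auto simp: verts_def)
    then show "v \<in> black_end T ` edges T" using edges_at_black[OF that v] by auto
  qed (use edge_ends[OF that] in auto)
  have Vw: "white T = white_end T ` edges T" if T: "plane_graph T" for T :: "('x, 'y) bicolored_plane_graph"
  proof (intro subset_antisym subsetI)
    fix v assume v: "v \<in> white T"
    then obtain e where "e \<in> edges_at T v" using plane_graphD(5)[OF T, of v] by (auto simp: verts_def)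
    then show "v \<in> white_end T ` edges T" using edges_at_white[OF that v] by auto
  qed (use edge_ends[OF that] in auto)
  have rb: "rot T (black_end T e) e \<in> edges T \<and> black_end T (rot T (black_end T e) e) = black_end T e"
    if "plane_graph T" "e \<in> edges T" for T :: "('x, 'y) bicolored_plane_graph" and e
    using edge_ends[OF that] plane_graphD(6)[OF that(1), of "black_end T e" e] edges_at_black[OF that(1)] that(2)
    by (auto simp: verts_def)
  have rw: "rot T (white_end T e) e \<in> edges T \<and> white_end T (rot T (white_end T e) e) = white_end T e"
    if "plane_graph T" "e \<in> edges T" for T :: "('x, 'y) bicolored_plane_graph" and e
    using edge_ends[OF that] plane_graphD(6)[OF that(1), of "white_end T e" e] edges_at_white[OF that(1)] that(2)
    by (auto simp: verts_def)
  have tb: "\<exists>k. (rot T (black_end T e) ^^ k) e = f"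
    if "plane_graph T" "e \<in> edges T" "f \<in> edges T" "black_end T e = black_end T f"
    for T :: "('x, 'y) bicolored_plane_graph" and e f
    using edge_ends[OF that(1,2)] plane_graphD(7)[OF that(1), of "black_end T e" e f] edges_at_black[OF that(1)] that
    by (auto simp: verts_def)
  have tw: "\<exists>k. (rot T (white_end T e) ^^ k) e = f"
    if "plane_graph T" "e \<in> edges T" "f \<in> edges T" "white_end T e = white_end T f"
    for T :: "('x, 'y) bicolored_plane_graph" and e f
    using edge_ends[OF that(1,2)] plane_graphD(7)[OF that(1), of "white_end T e" e f] edges_at_white[OF that(1)] that
    by (auto simp: verts_def)
  have "\<exists>\<phi>. bij_betw \<phi> (black G) (black H) \<and> (\<forall>e \<in> edges G. \<phi> (black_end G e) = black_end H (\<psi> e))"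
    by (rule orbit_map[where \<rho> = "rot G" and \<rho>' = "rot H"])
      (fact \<psi> Vb[OF G] Vb[OF H] rb[OF G] rb[OF H] tb[OF G] tb[OF H] bl)+
  then obtain \<phi>1 where \<phi>1: "bij_betw \<phi>1 (black G) (black H)"
      "\<And>e. e \<in> edges G \<Longrightarrow> \<phi>1 (black_end G e) = black_end H (\<psi> e)" by blast
  have "\<exists>\<phi>. bij_betw \<phi> (white G) (white H) \<and> (\<forall>e \<in> edges G. \<phi> (white_end G e) = white_end H (\<psi> e))"
    by (rule orbit_map[where \<rho> = "rot G" and \<rho>' = "rot H"])
      (fact \<psi> Vw[OF G] Vw[OF H] rw[OF G] rw[OF H] tw[OF G] tw[OF H] wh)+
  then obtain \<phi>2 where \<phi>2: "bij_betw \<phi>2 (white G) (white H)"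
      "\<And>e. e \<in> edges G \<Longrightarrow> \<phi>2 (white_end G e) = white_end H (\<psi> e)" by blast
  define \<phi> where "\<phi> v = (if v \<in> black G then \<phi>1 v else \<phi>2 v)" for v
  have dG: "black G \<inter> white G = {}" and dH: "black H \<inter> white H = {}"
    using plane_graphD(1) G H by auto
  have \<phi>b: "\<phi> v = \<phi>1 v" if "v \<in> black G" for v using that by (simp add: \<phi>_def)
  have \<phi>w: "\<phi> v = \<phi>2 v" if "v \<in> white G" for v using that dG by (auto simp: \<phi>_def)
  have bb: "bij_betw \<phi> (black G) (black H)" using \<phi>1(1) \<phi>b by (simp cong: bij_betw_cong)
  have bw: "bij_betw \<phi> (white G) (white H)" using \<phi>2(1) \<phi>w by (simp cong: bij_betw_cong)
  have bv: "bij_betw \<phi> (verts G) (verts H)" unfolding verts_def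
    by (rule bij_betw_combine[OF bb bw dH])
  have inc: "inc G v e \<longleftrightarrow> inc H (\<phi> v) (\<psi> e)" if "v \<in> verts G" "e \<in> edges G" for v e
  proof (cases "v \<in> black G")
    case True
    have "inc G v e \<longleftrightarrow> black_end G e = v" using inc_black_iff[OF G that(2) True] .
    also have "\<dots> \<longleftrightarrow> \<phi> (black_end G e) = \<phi> v"
      using bb True edge_ends[OF G that(2)] unfolding bij_betw_def by (meson inj_on_eq_iff)
    also have "\<dots> \<longleftrightarrow> black_end H (\<psi> e) = \<phi> v" using \<phi>b \<phi>1(2) edge_ends[OF G that(2)] that by simp
    also have "\<dots> \<longleftrightarrow> inc H (\<phi> v) (\<psi> e)"
      using inc_black_iff[OF H \<psi>E[OF that(2)], of "\<phi> v"] bb True by (auto simp: bij_betw_def)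
    finally show ?thesis .
  next
    case False
    then have T: "v \<in> white G" using that by (auto simp: verts_def)
    have "inc G v e \<longleftrightarrow> white_end G e = v" using inc_white_iff[OF G that(2) T] .
    also have "\<dots> \<longleftrightarrow> \<phi> (white_end G e) = \<phi> v"
      using bw T edge_ends[OF G that(2)] unfolding bij_betw_def by (meson inj_on_eq_iff)
    also have "\<dots> \<longleftrightarrow> white_end H (\<psi> e) = \<phi> v" using \<phi>w \<phi>2(2) edge_ends[OF G that(2)] that by simp
    also have "\<dots> \<longleftrightarrow> inc H (\<phi> v) (\<psi> e)"
      using inc_white_iff[OF H \<psi>E[OF that(2)], of "\<phi> v"] bw T by (auto simp: bij_betw_def)
    finally show ?thesis .
  qed
  have rot: "\<psi> (rot G v e) = rot H (\<phi> v) (\<psi> e)" if v: "v \<in> verts G" "e \<in> edges_at G v" for v e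
  proof (cases "v \<in> black G")
    case True
    then show ?thesis using that edges_at_black[OF G True] \<phi>b \<phi>1(2)[of e] bl[of e] by auto
  next
    case False
    then have T: "v \<in> white G" using that by (auto simp: verts_def)
    then show ?thesis using that edges_at_white[OF G T] \<phi>w \<phi>2(2)[of e] wh[of e] by auto
  qed
  show ?thesis unfolding plane_graph_iso_def
    using bv bb bw \<psi> inc rot by (intro exI[of _ \<phi>] exI[of _ \<psi>]) (auto simp: bij_betw_def)
qed

text \<open>The black end of an edge determines \<open>i\<close>, because each black vertex is
  joined to \<open>w\<close> by exactly one edge; the position in the orbit around that end
  determines \<open>k\<close>. The edges with \<open>k = 0\<close> are those at \<open>w\<close>,
  where turning advances \<open>i\<close>. All others end in a white leaf, where turning does
  nothing. Thus both rotations are expressed by the degrees alone.\<close>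

lemma centered_coordinates:
  assumes c: "centered T w" and e: "e \<in> edges_at T w"
  defines "I \<equiv> (SIGMA i:{..<vdegree T w}. {..<vdegree T (spoke_end T w e i)})"
  shows "bij_betw (edge_coord T w e) I (edges T)"
    and "(i, k) \<in> I \<Longrightarrow> rot T (black_end T (edge_coord T w e (i, k))) (edge_coord T w e (i, k)) =
           edge_coord T w e (i, Suc k mod vdegree T (spoke_end T w e i))"
    and "(i, k) \<in> I \<Longrightarrow> rot T (white_end T (edge_coord T w e (i, k))) (edge_coord T w e (i, k)) =
           (if k = 0 then edge_coord T w e (Suc i mod vdegree T w, 0) else edge_coord T w e (i, k))"
    and "i < vdegree T w \<Longrightarrow> 0 < vdegree T (spoke_end T w e i)"
proof -
  have T: "plane_graph T" and w: "w \<in> white T" "w \<in> verts T"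
    and inj: "inj_on (black_end T) (edges_at T w)" and im: "black_end T ` edges_at T w = black T"
    and leaf: "\<And>u. u \<in> white T \<Longrightarrow> u \<noteq> w \<Longrightarrow> vdegree T u = 1"
    using c unfolding centered_def verts_def by blast+
  let ?m = "vdegree T w" and ?s = "spoke T w e" and ?b = "spoke_end T w e"
  let ?d = "\<lambda>i. vdegree T (?b i)" and ?F = "edge_coord T w e"
  have sp: "bij_betw ?s {..<?m} (edges_at T w)"
    using rot_orbit(1)[OF T w(2) e] by (simp add: spoke_def[abs_def])
  have s: "?s i \<in> edges_at T w" "?s i \<in> edges T" for i
    using rot_orbit(3)[OF T w(2) e] by (auto simp: spoke_def edges_at_def)
  have b: "?b i \<in> black T" "?b i \<in> verts T" for i
    using edge_ends(1)[OF T s(2)] by (auto simp: spoke_end_def verts_def)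
  have sb: "?s i \<in> edges_at T (?b i)" for i
    using edges_at_black[OF T b(1)] s by (auto simp: spoke_end_def)
  note orb = rot_orbit[OF T b(2) sb]
  have F: "?F (i, k) \<in> edges_at T (?b i)" for i k using orb(3) by (simp add: edge_coord_def)
  have F': "?F (i, k) \<in> edges T" "black_end T (?F (i, k)) = ?b i" for i k
    using F[of i k] edges_at_black[OF T b(1)] by auto
  have F0: "?F (i, 0) = ?s i" for i by (simp add: edge_coord_def)
  show pos: "0 < ?d i" for i
    using F[of i 0] plane_graphD(4)[OF T b(2)] by (auto simp: vdegree_def card_gt_0_iff)
  have inj': "inj_on ?F I"
  proof (rule inj_onI, clarify)
    fix i k j l assume *: "(i, k) \<in> I" "(j, l) \<in> I" "?F (i, k) = ?F (j, l)"
    then have "?b i = ?b j" using F'(2) by metis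
    then have "?s i = ?s j" using inj s by (auto simp: spoke_end_def dest: inj_onD)
    then have ij: "i = j" using sp * by (auto simp: I_def bij_betw_def dest: inj_onD)
    then have "k = l" using * orb(1)[of i] by (auto simp: I_def bij_betw_def edge_coord_def dest: inj_onD)
    with ij show "i = j \<and> k = l" by simp
  qed
  have "?F ` I = edges T"
  proof (intro subset_antisym subsetI)
    fix f assume f: "f \<in> edges T"
    have "black_end T f \<in> black_end T ` ?s ` {..<?m}"
      using edge_ends(1)[OF T f] im sp by (simp add: bij_betw_def)
    then obtain i where i: "i < ?m" "black_end T f = ?b i" by (auto simp: spoke_end_def)
    then have "f \<in> edges_at T (?b i)" using edges_at_black[OF T b(1)] f by auto
    then obtain k where "k < ?d i" "f = (rot T (?b i) ^^ k) (?s i)"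
      using orb(1)[of i] unfolding bij_betw_def by blast
    then show "f \<in> ?F ` I" using i by (intro image_eqI[of _ _ "(i, k)"]) (auto simp: edge_coord_def I_def)
  qed (use F' in auto)
  with inj' show "bij_betw ?F I (edges T)" by (simp add: bij_betw_def)
  show "rot T (black_end T (?F (i, k))) (?F (i, k)) = ?F (i, Suc k mod ?d i)"
    using F'(2) funpow_mod_eq[OF orb(2), of "Suc k" i] by (simp add: edge_coord_def)
  show "rot T (white_end T (?F (i, k))) (?F (i, k)) =
      (if k = 0 then ?F (Suc i mod ?m, 0) else ?F (i, k))" if ik: "(i, k) \<in> I"
  proof (cases "k = 0")
    case True
    have "white_end T (?s i) = w" using edges_at_white[OF T w(1)] s(1)[of i] by auto
    then show ?thesis using True F0 funpow_mod_eq[OF rot_orbit(2)[OF T w(2) e], of "Suc i"]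
      by (simp add: spoke_def)
  next
    case False
    let ?u = "white_end T (?F (i, k))"
    have u: "?u \<in> white T" "?u \<in> verts T" using edge_ends[OF T F'(1)] by (auto simp: verts_def)
    have fu: "?F (i, k) \<in> edges_at T ?u" using edges_at_white[OF T u(1)] F' by auto
    \<comment> \<open>An edge at \<open>w\<close> with black end \<open>?b i\<close> must be the
      spoke \<open>?s i\<close>, whose coordinate is \<open>(i, 0)\<close>; injectivity of the
      coordinates excludes this for positive \<open>k\<close>.\<close>
    have "?u \<noteq> w"
    proof
      assume "?u = w"
      then have "?F (i, k) = ?s i"
        using fu inj s(1)[of i] F'(2)[of i k] by (auto simp: spoke_end_def dest: inj_onD)
      then have "?F (i, k) = ?F (i, 0)" using F0 by simp
      moreover have "(i, 0) \<in> I" using ik pos by (auto simp: I_def)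
      ultimately show False using inj' ik False by (auto dest: inj_onD)
    qed
    then have "edges_at T ?u = {?F (i, k)}"
      using leaf[OF u(1)] fu unfolding vdegree_def by (metis card_1_singletonE singletonD)
    then show ?thesis using plane_graphD(6)[OF T u(2) fu] False by simp
  qed
qed

text \<open>Equal degree lists give the same index set \<open>I\<close> and the same rotation
  formulas in coordinates. Hence sending each edge of \<open>G\<close> to the edge of
  \<open>H\<close> with the same coordinates commutes with both rotations.\<close>

theorem centered_iso:
  assumes G: "centered G w" "e \<in> edges_at G w" and H: "centered H w'" "e' \<in> edges_at H w'"
    and eq: "black_degrees_around G w e = black_degrees_around H w' e'"
  shows "plane_graph_iso G H"
proof -
  let ?F = "edge_coord G w e" and ?F' = "edge_coord H w' e'"
  define I where "I = (SIGMA i:{..<vdegree G w}. {..<vdegree G (spoke_end G w e i)})"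
  have m: "vdegree G w = vdegree H w'"
    using arg_cong[OF eq, of length] by (simp add: black_degrees_around_def)
  have d: "vdegree G (spoke_end G w e i) = vdegree H (spoke_end H w' e' i)" if "i < vdegree G w" for i
    using arg_cong[OF eq, of "\<lambda>l. l ! i"] that m
    by (simp add: black_degrees_around_def spoke_end_def spoke_def)
  have I': "I = (SIGMA i:{..<vdegree H w'}. {..<vdegree H (spoke_end H w' e' i)})"
    unfolding I_def using m d by auto
  note CG = centered_coordinates[OF G, folded I_def] and CH = centered_coordinates[OF H, folded I']
  define \<psi> where "\<psi> = ?F' \<circ> inv_into I ?F"
  have \<psi>: "\<psi> (?F x) = ?F' x" if "x \<in> I" for x
    using that CG(1) by (simp add: \<psi>_def bij_betw_inv_into_left)
  have bij: "bij_betw \<psi> (edges G) (edges H)"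
    unfolding \<psi>_def using CG(1) CH(1) by (meson bij_betw_inv_into bij_betw_trans)
  have I: "\<exists>i k. f = ?F (i, k) \<and> (i, k) \<in> I" if "f \<in> edges G" for f
    using that CG(1) unfolding bij_betw_def by force
  show ?thesis
  proof (rule plane_graph_isoI[OF _ _ bij])
    fix f assume "f \<in> edges G"
    then obtain i k where f: "f = ?F (i, k)" "(i, k) \<in> I" using I by blast
    have *: "i < vdegree G w" "k < vdegree G (spoke_end G w e i)" using f(2) by (auto simp: I_def)
    have "(i, Suc k mod vdegree G (spoke_end G w e i)) \<in> I" using * by (auto simp: I_def)
    then show "\<psi> (rot G (black_end G f) f) = rot H (black_end H (\<psi> f)) (\<psi> f)"
      using f CG(2) CH(2) \<psi> d[OF *(1)] by simp
    have "Suc i mod vdegree G w < vdegree G w" using * by auto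
    then have "(Suc i mod vdegree G w, 0) \<in> I" using CG(4) by (auto simp: I_def)
    then show "\<psi> (rot G (white_end G f) f) = rot H (white_end H (\<psi> f)) (\<psi> f)"
      using f CG(3) CH(3) \<psi> m by simp
  qed (use G H in \<open>auto simp: centered_def\<close>)
qed

subsection \<open>The preimage of the segment under a polynomial\<close>

text \<open>Over a regular value, \<open>p - [:x:]\<close> shares no root with its derivative, so it
  is squarefree and has as many roots as its degree.\<close>

lemma card_fibre:
  fixes p :: "complex poly"
  assumes "degree p > 0" and reg: "\<And>z. poly p z = x \<Longrightarrow> poly (pderiv p) z \<noteq> 0"
  shows "card {z. poly p z = x} = degree p"
proof -
  let ?q = "p - [:x:]"
  have q: "poly ?q z = 0 \<longleftrightarrow> poly p z = x" for z by simp
  have deg: "degree ?q = degree p"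
    using assms(1) by (metis degree_add_eq_left degree_pCons_0 diff_conv_add_uminus minus_pCons minus_zero)
  have "pderiv ?q = pderiv p" by (simp add: pderiv_diff)
  then have "rsquarefree ?q" using reg by (auto simp: rsquarefree_roots)
  then have "?q = smult (lead_coeff ?q) (\<Prod>z|poly ?q z = 0. [:-z, 1:])"
    by (rule complex_poly_decompose_rsquarefree[symmetric])
  moreover have "?q \<noteq> 0" using deg assms(1) by (metis degree_0 less_irrefl)
  then have "lead_coeff ?q \<noteq> 0" using leading_coeff_0_iff by blast
  ultimately have "degree ?q = degree (\<Prod>z|poly ?q z = 0. [:-z, 1:])" by (metis degree_smult_eq)
  also have "\<dots> = card {z. poly ?q z = 0}" by (subst degree_prod_sum_eq) auto
  finally show ?thesis using deg q by simp
qed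

text \<open>The inverse function theorem gives a sheet near each point of a fibre. That no further
  sheets lie over a small neighbourhood follows by counting, as all fibres over \<open>S\<close>
  have \<open>degree p\<close> points.\<close>

lemma poly_covering_space:
  fixes p :: "complex poly"
  assumes deg: "degree p > 0" and reg: "\<And>z. poly p z \<in> S \<Longrightarrow> poly (pderiv p) z \<noteq> 0"
  shows "covering_space {z. poly p z \<in> S} (poly p) S"
  unfolding covering_space_def
proof (intro conjI ballI)
  let ?c = "{z. poly p z \<in> S}"
  have card: "card {z. poly p z = x} = degree p" if "x \<in> S" for x
    by (rule card_fibre[OF deg]) (use reg that in blast)
  have fin: "finite {z. poly p z = x}" if "x \<in> S" for x
    using card[OF that] deg by (metis card.infinite less_irrefl)
  show "continuous_on ?c (poly p)" by (intro continuous_intros)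
  show "poly p ` ?c = S"
  proof (intro subset_antisym subsetI)
    fix x assume x: "x \<in> S"
    then have "{z. poly p z = x} \<noteq> {}" using card[OF x] deg by (metis card.empty less_irrefl)
    with x show "x \<in> poly p ` ?c" by auto
  qed auto
  fix x assume x: "x \<in> S"
  define Z where "Z = {z. poly p z = x}"
  have finZ: "finite Z" using fin[OF x] by (simp add: Z_def)
  \<comment> \<open>Points of the fibre are separated, so balls of half these radii are pairwise
    disjoint.\<close>
  have "\<exists>d > 0. \<forall>y \<in> Z. y \<noteq> z \<longrightarrow> d \<le> dist z y" for z by (rule finite_set_avoid[OF finZ])
  then obtain d where d: "\<And>z. d z > 0" "\<And>z y. y \<in> Z \<Longrightarrow> y \<noteq> z \<Longrightarrow> d z \<le> dist z y" by metis
  have "\<exists>r > 0. ball z r \<subseteq> ball z (d z / 2) \<and> open (poly p ` ball z r) \<and> inj_on (poly p) (ball z r)"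
    if z: "z \<in> Z" for z
  proof -
    have "deriv (poly p) z \<noteq> 0"
      using reg[of z] z x by (simp add: Z_def DERIV_imp_deriv[OF poly_DERIV])
    moreover have "poly p holomorphic_on ball z (d z / 2)" by (intro holomorphic_intros)
    ultimately show ?thesis using d(1)[of z]
      by (meson has_complex_derivative_locally_invertible centre_in_ball half_gt_zero open_ball)
  qed
  then obtain r where r: "\<And>z. z \<in> Z \<Longrightarrow> r z > 0" "\<And>z. z \<in> Z \<Longrightarrow> ball z (r z) \<subseteq> ball z (d z / 2)"
      "\<And>z. z \<in> Z \<Longrightarrow> open (poly p ` ball z (r z))" "\<And>z. z \<in> Z \<Longrightarrow> inj_on (poly p) (ball z (r z))"
    by metis
  have disj: "ball y (r y) \<inter> ball z (r z) = {}" if "y \<in> Z" "z \<in> Z" "y \<noteq> z" for y z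
  proof -
    have "d y \<le> dist y z" "d z \<le> dist y z" using d(2) that by (metis dist_commute)+
    then have "ball y (d y / 2) \<inter> ball z (d z / 2) = {}" by (intro disjoint_ballI) auto
    then show ?thesis using r(2) that by blast
  qed
  define W where "W = (\<Inter>z\<in>Z. poly p ` ball z (r z))"
  define V where "V z = ball z (r z) \<inter> {u. poly p u \<in> S \<inter> W}" for z
  have W: "open W" "x \<in> W" unfolding W_def using r(1,3) finZ by (force simp: Z_def)+
  \<comment> \<open>Each of the \<open>degree p\<close> disjoint balls contains a point of the fibre
    of \<open>poly p u\<close>, which has only \<open>degree p\<close> points; hence all of them,
    \<open>u\<close> included, lie in the balls.\<close>
  have cover: "\<exists>z \<in> Z. u \<in> ball z (r z)" if u: "poly p u \<in> S \<inter> W" for u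
  proof -
    let ?Y = "{v. poly p v = poly p u}"
    have "\<exists>v. v \<in> ball z (r z) \<and> poly p v = poly p u" if "z \<in> Z" for z
      using u that unfolding W_def by fastforce
    then obtain f where f: "\<And>z. z \<in> Z \<Longrightarrow> f z \<in> ball z (r z)" "\<And>z. z \<in> Z \<Longrightarrow> poly p (f z) = poly p u"
      by metis
    have "inj_on f Z" using f(1) disj by (intro inj_onI) (metis IntI empty_iff)
    moreover have "f ` Z \<subseteq> ?Y" using f(2) by auto
    moreover have "card Z = card ?Y" "finite ?Y" using card fin x u by (auto simp: Z_def)
    ultimately have "f ` Z = ?Y" by (metis card_image card_subset_eq)
    moreover have "u \<in> ?Y" by simp
    ultimately show ?thesis using f(1) by (metis imageE)
  qed
  have "\<Union>(V ` Z) = ?c \<inter> poly p -` (S \<inter> W)" using cover by (auto simp: V_def)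
  moreover have "openin (top_of_set ?c) (V z)" for z
  proof -
    have "open (ball z (r z) \<inter> poly p -` W)"
      using W(1) by (intro open_Int open_ball open_vimage continuous_intros) auto
    moreover have "V z = ?c \<inter> (ball z (r z) \<inter> poly p -` W)" by (auto simp: V_def)
    ultimately show ?thesis by (simp add: openin_open_Int)
  qed
  moreover have "pairwise disjnt (V ` Z)"
    unfolding pairwise_def disjnt_def V_def using disj by blast
  moreover have "\<exists>q. homeomorphism (V z) (S \<inter> W) (poly p) q" if z: "z \<in> Z" for z
  proof -
    obtain q where q: "homeomorphism (ball z (r z)) (poly p ` ball z (r z)) (poly p) q"
      using invariance_of_domain_homeomorphism[OF open_ball
          continuous_on_poly[OF continuous_on_id] order_refl r(4)[OF z]] by blast
    have "x \<in> poly p ` ball z (r z)" if "x \<in> W" for x using z that unfolding W_def by blast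
    then have "poly p ` V z = S \<inter> W" unfolding V_def by blast
    then show ?thesis using homeomorphism_of_subsets[OF q _ order_refl, of "V z" "S \<inter> W"]
      by (auto simp: V_def)
  qed
  moreover have "openin (top_of_set S) (S \<inter> W)" using W(1) by (simp add: openin_open_Int)
  ultimately show "\<exists>T. x \<in> T \<and> openin (top_of_set S) T \<and>
      (\<exists>v. \<Union>v = ?c \<inter> poly p -` T \<and> (\<forall>u\<in>v. openin (top_of_set ?c) u) \<and> pairwise disjnt v \<and>
        (\<forall>u\<in>v. \<exists>q. homeomorphism u T (poly p) q))"
    using x W(2) by (intro exI[of _ "S \<inter> W"] conjI exI[of _ "V ` Z"]) auto
qed

text \<open>A convex set is simply connected, so the identity of \<open>S\<close> lifts to a section
  \<open>g\<close> through a point \<open>a\<close> of \<open>e\<close>. On the connected set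
  \<open>e\<close>, both \<open>g \<circ> p\<close> and the inclusion lift \<open>p\<close> and
  agree at \<open>a\<close>; hence \<open>g\<close> inverts \<open>p\<close> on
  \<open>e\<close>.\<close>

lemma covering_component:
  fixes p :: "'a::real_normed_vector \<Rightarrow> 'b::real_normed_vector"
  assumes cov: "covering_space C p S" and S: "convex S" "locally path_connected S" and e: "e \<in> components C"
  shows "inj_on p e" "p ` e = S"
proof -
  obtain a where a: "a \<in> C" "e = connected_component_set C a" using e by (auto simp: components_def)
  have contp: "continuous_on C p" and im: "p ` C = S" using cov by (auto simp: covering_space_def)
  have eC: "e \<subseteq> C" and ae: "a \<in> e" and con: "connected e"
    using a e by (auto simp: in_components_subset intro: in_components_connected)
  have pa: "p a \<in> S" using a im by auto
  obtain g where g: "continuous_on S g" "g \<in> S \<rightarrow> C" "g (p a) = a" "\<And>y. y \<in> S \<Longrightarrow> p (g y) = y"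
    by (rule covering_space_lift_strong[OF cov a(1) pa convex_imp_simply_connected[OF S(1)] S(2)
          continuous_on_id]) auto
  have ge: "g ` S \<subseteq> e" unfolding a(2)
  proof (rule connected_component_maximal)
    show "a \<in> g ` S" using pa g(3) by force
    show "connected (g ` S)" using connected_continuous_image[OF g(1)] S(1) convex_connected by blast
  qed (use g(2) in auto)
  have pe: "p x \<in> S" if "x \<in> e" for x using that eC im by blast
  have contpe: "continuous_on e p" using contp eC continuous_on_subset by blast
  have "continuous_on e (g \<circ> p)"
    by (rule continuous_on_compose[OF contpe continuous_on_subset[OF g(1)]]) (use pe in auto)
  moreover have "p \<in> e \<rightarrow> S" "g \<circ> p \<in> e \<rightarrow> C" "id \<in> e \<rightarrow> C"
    using pe eC g(2) by (auto simp: Pi_iff)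
  moreover have "p x = p ((g \<circ> p) x)" "p x = p (id x)" if "x \<in> e" for x
    using g(4)[OF pe[OF that]] by auto
  moreover have "(g \<circ> p) a = id a" using g(3) by simp
  ultimately have "(g \<circ> p) y = id y" if "y \<in> e" for y
    using covering_space_lift_unique[OF cov, of "g \<circ> p" a id e p y] contpe con ae that
      continuous_on_id' by blast
  then have gp: "g (p y) = y" if "y \<in> e" for y using that by simp
  show "inj_on p e" using gp by (rule inj_on_inverseI)
  show "p ` e = S"
  proof (intro subset_antisym subsetI)
    fix y assume "y \<in> S"
    then show "y \<in> p ` e" using ge g(4)[of y] by (intro image_eqI[of _ _ "g y"]) auto
  qed (use pe in blast)
qed

section \<open>Components of the preimage of the open segment and their end points\<close>

definition preimage_01 :: "complex poly \<Rightarrow> complex set" where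
  "preimage_01 p = {z. poly p z \<in> open_segment 0 1}"

lemma open_segment_01: "open_segment 0 1 = complex_of_real ` {0<..<1}"
proof (intro subset_antisym subsetI)
  fix z :: complex assume "z \<in> open_segment 0 1"
  then obtain u where "0 < u" "u < 1" "z = of_real u"
    unfolding in_segment by (auto simp: scaleR_conv_of_real)
  then show "z \<in> complex_of_real ` {0<..<1}" by simp
next
  fix z :: complex assume "z \<in> complex_of_real ` {0<..<1}"
  then obtain u where "0 < u" "u < 1" "z = of_real u" by auto
  then show "z \<in> open_segment 0 1" unfolding in_segment
    by (intro conjI exI[of _ u]) (simp_all add: scaleR_conv_of_real)
qed

lemma edge_bij:
  assumes p: "shabat_polynomial 0 1 p" and e: "e \<in> components (preimage_01 p)"
  shows "inj_on (poly p) e" "poly p ` e = open_segment 0 1"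
proof -
  have "covering_space (preimage_01 p) (poly p) (open_segment 0 1)"
    unfolding preimage_01_def using p
    by (intro poly_covering_space) (auto simp: shabat_polynomial_def critical_values_def open_segment_def)
  note cov = this
  have "locally path_connected (open_segment 0 (1::complex))"
    by (intro convex_imp_locally_path_connected convex_open_segment)
  from covering_component[OF cov convex_open_segment this e]
  show "inj_on (poly p) e" "poly p ` e = open_segment 0 1" .
qed

lemma compact_poly_vimage:
  fixes p :: "complex poly"
  assumes "degree p > 0" "compact K"
  shows "compact {z. poly p z \<in> K}"
proof -
  have "compact {z. (\<Sum>i\<le>degree p. coeff p i * z ^ i) \<in> K}"
    using proper_map_polyfun_univ[of K "coeff p" "degree p" "degree p"] assms by fastforce
  then show ?thesis by (simp add: poly_altdef)
qed

text \<open>Points of \<open>e\<close> whose values tend to 0 stay in a compact set by properness of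
  \<open>p\<close>; a limit of a subsequence is a root in the closure.\<close>

lemma edge_closure_black:
  assumes p: "shabat_polynomial 0 1 p" and e: "e \<in> components (preimage_01 p)"
  shows "\<exists>v \<in> closure e. poly p v = 0"
proof -
  \<comment> \<open>The summand 2 keeps the value strictly below 1 already for
    \<open>n = 0\<close>.\<close>
  have "\<exists>z. z \<in> e \<and> poly p z = of_real (1 / (real n + 2))" for n
  proof -
    have "complex_of_real (1 / (real n + 2)) \<in> open_segment 0 1"
      unfolding open_segment_01 by (rule imageI) simp
    then show ?thesis using edge_bij(2)[OF p e] by (metis imageE)
  qed
  then obtain z where z: "\<And>n. z n \<in> e" "\<And>n. poly p (z n) = of_real (1 / (real n + 2))" by metis
  have cpt: "compact {z. poly p z \<in> cball 0 1}"
    using p by (intro compact_poly_vimage) (auto simp: shabat_polynomial_def)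
  have "z n \<in> {z. poly p z \<in> cball 0 1}" for n by (auto simp: z(2) norm_divide simp flip: of_real_add)
  then obtain v s where v: "strict_mono s" "(z \<circ> s) \<longlonglongrightarrow> v"
    using cpt unfolding compact_def by metis
  have "(\<lambda>n. poly p (z (s n))) \<longlonglongrightarrow> poly p v"
    using v(2) by (intro tendsto_intros) (simp add: o_def)
  moreover have "(\<lambda>n. complex_of_real (1 / (real n + 2))) \<longlonglongrightarrow> of_real 0"
    by (intro tendsto_of_real) real_asymp
  then have "(\<lambda>n. poly p (z (s n))) \<longlonglongrightarrow> 0"
    using LIMSEQ_subseq_LIMSEQ[OF _ v(1)] by (fastforce simp: z(2) o_def)
  ultimately have "poly p v = 0" using LIMSEQ_unique by blast
  moreover have "v \<in> closure e" unfolding closure_sequential using v z by (intro exI[of _ "z \<circ> s"]) auto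
  ultimately show ?thesis by blast
qed

subsection \<open>Edges near a vertex\<close>

text \<open>Write \<open>p\<close> as \<open>(z - v)^k * q\<close> with \<open>q\<close> nonzero at
  \<open>v\<close>, and let \<open>g\<close> be a local \<open>k\<close>-th root of
  \<open>q\<close>. Then \<open>h z = (z - v) * g z\<close> is a local coordinate with
  \<open>p = h^k\<close>, so small positive values of \<open>p\<close> occur exactly on the
  \<open>k\<close> rays where \<open>h\<close> is a positive multiple of a \<open>k\<close>-th root
  of unity. The clause relating \<open>r\<close>, \<open>g\<close> and \<open>u\<close> retains
  their directions.\<close>

lemma root_rays:
  fixes p :: "complex poly"
  assumes p: "p \<noteq> 0" "poly p v = 0" and N: "open N" "v \<in> N"
  defines "k \<equiv> order v p" and "u \<equiv> \<lambda>j. cis (2 * pi * real j / real (order v p))"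
  obtains U r g \<epsilon> where "open U" "v \<in> U" "U \<subseteq> N" "0 < \<epsilon>"
    "isCont g v" "g v \<noteq> (0 :: complex)"
    "\<And>z. z \<in> U \<Longrightarrow> z \<in> preimage_01 p \<Longrightarrow> \<exists>j<k. \<exists>t. 0 < t \<and> t < \<epsilon> \<and> z = r j t"
    "\<And>j t. j < k \<Longrightarrow> 0 < t \<Longrightarrow> t < \<epsilon> \<Longrightarrow> r j t \<in> U \<inter> preimage_01 p \<and> poly p (r j t) = of_real (t ^ k)"
    "\<And>j t. j < k \<Longrightarrow> 0 < t \<Longrightarrow> t < \<epsilon> \<Longrightarrow> (r j t - v) * g (r j t) = of_real t * u j"
    "\<And>j. continuous_on {0<..<\<epsilon>} (r j)" "\<And>j. (r j \<longlongrightarrow> v) (at_right 0)"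
proof -
  obtain q where q: "p = [:-v, 1:] ^ k * q" "\<not> [:-v, 1:] dvd q"
    using order_decomp[OF p(1), of v] by (auto simp: k_def)
  have k: "k > 0" using p by (simp add: k_def order_gt_0_iff)
  have qv: "poly q v \<noteq> 0" using q(2) by (simp add: poly_eq_0_iff_dvd)
  have "open (N \<inter> poly q -` (- {0}))"
    using N by (intro open_Int open_vimage continuous_intros) auto
  moreover have "v \<in> N \<inter> poly q -` (- {0})" using N qv by simp
  ultimately obtain d where d: "d > 0" "ball v d \<subseteq> N \<inter> poly q -` (- {0})"
    using open_contains_ball_eq by blast
  have "poly q holomorphic_on ball v d" by (intro holomorphic_intros)
  moreover have "poly q z \<noteq> 0" if "z \<in> ball v d" for z using d(2) that by auto
  \<comment> \<open>A nonvanishing holomorphic function on a disc has a logarithm; dividing it by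
    \<open>k\<close> yields the \<open>k\<close>-th root \<open>g\<close>.\<close>
  ultimately obtain L where L: "L holomorphic_on ball v d" "\<And>z. z \<in> ball v d \<Longrightarrow> poly q z = exp (L z)"
    using contractible_imp_holomorphic_log[of "poly q" "ball v d"] convex_imp_contractible[OF convex_ball]
    by blast
  define g where "g z = exp (L z / of_nat k)" for z
  define h where "h z = (z - v) * g z" for z
  have g: "g holomorphic_on ball v d" unfolding g_def using k by (intro holomorphic_intros L(1)) auto
  have gk: "g z ^ k = poly q z" if "z \<in> ball v d" for z
    unfolding g_def using k L(2)[OF that] by (simp flip: exp_of_nat_mult)
  have contg: "isCont g v"
    using holomorphic_on_imp_continuous_on[OF g] d(1) by (simp add: continuous_on_eq_continuous_at)
  have h: "h holomorphic_on ball v d" unfolding h_def by (intro holomorphic_intros g)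
  have ph: "poly p z = h z ^ k" if "z \<in> ball v d" for z
    unfolding h_def power_mult_distrib gk[OF that] by (subst q(1)) (simp add: poly_power)
  have "(g has_field_derivative deriv g v) (at v)"
    using g d(1) holomorphic_derivI open_ball centre_in_ball by blast
  then have "(h has_field_derivative g v) (at v)"
    unfolding h_def by (auto intro!: derivative_eq_intros)
  then have "deriv h v \<noteq> 0" by (simp add: DERIV_imp_deriv g_def)
  then obtain \<delta> where \<delta>: "\<delta> > 0" "ball v \<delta> \<subseteq> ball v d" "open (h ` ball v \<delta>)" "inj_on h (ball v \<delta>)"
    using has_complex_derivative_locally_invertible[OF h, of v] d(1) by auto
  have conth: "continuous_on (ball v \<delta>) h"
    using holomorphic_on_imp_continuous_on[OF h] \<delta>(2) continuous_on_subset by blast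
  obtain h' where h': "homeomorphism (ball v \<delta>) (h ` ball v \<delta>) h h'"
    using invariance_of_domain_homeomorphism[OF open_ball conth order_refl \<delta>(4)] by blast
  have hv: "h v = 0" by (simp add: h_def)
  then have "0 \<in> h ` ball v \<delta>" using \<delta>(1) by force
  then obtain e where e: "e > 0" "ball 0 e \<subseteq> h ` ball v \<delta>" using \<delta>(3) open_contains_ball_eq by blast
  \<comment> \<open>The bound 1 ensures \<open>t ^ k < 1\<close>, so the rays stay over the open
    segment.\<close>
  define \<epsilon> where "\<epsilon> = min e 1"
  have \<epsilon>: "0 < \<epsilon>" "\<epsilon> \<le> 1" "ball 0 \<epsilon> \<subseteq> h ` ball v \<delta>" using e by (auto simp: \<epsilon>_def)
  define U where "U = ball v \<delta> \<inter> h -` ball 0 \<epsilon>"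
  define r where "r j t = h' (of_real t * u j)" for j t
  have [simp]: "norm (u j) = 1" for j by (simp add: u_def)
  have uk: "u j ^ k = 1" if "j < k" for j
    using Complex.bij_betw_roots_unity[OF k] that unfolding u_def k_def[symmetric]
    by (auto simp: bij_betw_def)
  have hh': "h (h' w) = w" "h' w \<in> ball v \<delta>" "h' w \<in> U" if "w \<in> ball 0 \<epsilon>" for w
  proof -
    have w: "w \<in> h ` ball v \<delta>" using that \<epsilon> by blast
    show 1: "h (h' w) = w" using homeomorphism_apply2[OF h' w] .
    show "h' w \<in> ball v \<delta>" using w homeomorphism_image2[OF h'] by blast
    with 1 that show "h' w \<in> U" by (simp add: U_def)
  qed
  have tu: "of_real t * u j \<in> ball 0 \<epsilon>" if "0 \<le> t" "t < \<epsilon>" for t j using that by (simp add: norm_mult)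
  have conth': "continuous_on (ball 0 \<epsilon>) h'"
    using homeomorphism_cont2[OF h'] \<epsilon>(3) continuous_on_subset by blast
  show thesis
  proof (rule that[of U \<epsilon> g r])
    show "open U" unfolding U_def
      using continuous_open_preimage[OF conth open_ball open_ball] .
    show "v \<in> U" using \<delta>(1) \<epsilon>(1) hv by (simp add: U_def)
    show "U \<subseteq> N" using \<delta>(2) d(2) by (auto simp: U_def)
    show "isCont g v" "g v \<noteq> 0" "0 < \<epsilon>" using contg \<epsilon> by (auto simp: g_def)
    show "\<exists>j<k. \<exists>t. 0 < t \<and> t < \<epsilon> \<and> z = r j t" if z: "z \<in> U" "z \<in> preimage_01 p" for z
    proof -
      have zd: "z \<in> ball v d" "z \<in> ball v \<delta>" using z(1) \<delta>(2) by (auto simp: U_def)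
      obtain s where s: "0 < s" "s < 1" "h z ^ k = of_real s"
        using z(2) ph[OF zd(1)] unfolding preimage_01_def open_segment_01 by auto
      \<comment> \<open>Polar decomposition: the modulus of \<open>h z\<close> is the ray parameter,
        and its phase is a \<open>k\<close>-th root of unity because \<open>h z ^ k\<close> is
        positive.\<close>
      let ?t = "norm (h z)"
      have t: "0 < ?t" using s k by (auto simp: power_0_left)
      have "?t ^ k = s" using arg_cong[OF s(3), of norm] s(1) by (simp add: norm_power)
      then have "(h z / of_real ?t) ^ k = 1" using s by (simp add: power_divide flip: of_real_power)
      then obtain j where j: "j < k" "h z / of_real ?t = u j"
        using Complex.bij_betw_roots_unity[OF k] unfolding bij_betw_def u_def k_def[symmetric] by blast
      have "h z = of_real ?t * u j" using j(2) t by (simp add: field_simps)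
      then have "z = r j ?t" using homeomorphism_apply1[OF h' zd(2)] by (metis r_def)
      moreover have "?t < \<epsilon>" using z(1) by (simp add: U_def)
      ultimately show ?thesis using j(1) t by blast
    qed
    show "r j t \<in> U \<inter> preimage_01 p \<and> poly p (r j t) = of_real (t ^ k)" if "j < k" "0 < t" "t < \<epsilon>" for j t
    proof -
      note tu' = hh'[OF tu[of t j, OF less_imp_le[OF that(2)] that(3)]]
      have "r j t \<in> ball v d" using tu'(2) \<delta>(2) by (auto simp: r_def)
      then have pr: "poly p (r j t) = of_real (t ^ k)"
        using ph[of "r j t"] tu'(1) by (simp add: r_def power_mult_distrib uk[OF that(1)])
      have "t ^ k < 1" using that \<epsilon> k by (intro power_less_one_iff[THEN iffD2]) auto
      then have "complex_of_real (t ^ k) \<in> complex_of_real ` {0<..<1}"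
        using that by (intro imageI) simp
      then have "r j t \<in> preimage_01 p" unfolding preimage_01_def open_segment_01 by (simp add: pr)
      with pr tu'(3) show ?thesis by (simp add: r_def)
    qed
    show "(r j t - v) * g (r j t) = of_real t * u j" if "j < k" "0 < t" "t < \<epsilon>" for j t
      using hh'(1)[OF tu[of t j]] that by (simp add: r_def h_def)
    show "continuous_on {0<..<\<epsilon>} (r j)" for j unfolding r_def
      by (rule continuous_on_compose2[OF conth']) (use tu in \<open>auto intro!: continuous_intros\<close>)
    show "(r j \<longlongrightarrow> v) (at_right 0)" for j
    proof -
      have "isCont h' 0" using conth' \<epsilon>(1) by (simp add: continuous_on_eq_continuous_at)
      moreover have "((\<lambda>t. complex_of_real t * u j) \<longlongrightarrow> of_real 0 * u j) (at_right 0)"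
        by (intro tendsto_intros)
      ultimately have "(r j \<longlongrightarrow> h' 0) (at_right 0)"
        unfolding r_def by (intro isCont_tendsto_compose[of 0 h']) auto
      moreover have "h' 0 = v" using homeomorphism_apply1[OF h', of v] \<delta>(1) hv by simp
      ultimately show ?thesis by simp
    qed
  qed
qed

lemma ray_in_edge:
  assumes e: "e \<in> components S" and r: "continuous_on {a<..<b::real} r" "r ` {a<..<b} \<subseteq> S"
    and t: "a < t" "t < b" "r t \<in> e"
  shows "r ` {a<..<b} \<subseteq> e"
proof -
  have "connected (r ` {a<..<b})" using r(1) by (intro connected_continuous_image) auto
  then show ?thesis using components_maximal[OF e _ r(2)] t by fastforce
qed

text \<open>An edge that accumulates at \<open>v\<close> meets the neighbourhood \<open>U\<close>
  and therefore contains a whole ray. Along that ray \<open>p\<close> takes all small positive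
  values, however small \<open>N\<close> is.\<close>

lemma edge_near_root:
  assumes p: "shabat_polynomial 0 1 p" "poly p v = 0"
    and e: "e \<in> components (preimage_01 p)" "v \<in> closure e" and N: "open N" "v \<in> N"
  shows "\<exists>\<delta>>0. \<forall>t. 0 < t \<and> t < \<delta> \<longrightarrow> (\<exists>z \<in> e \<inter> N. poly p z = of_real t)"
proof -
  have p0: "p \<noteq> 0" using p by (auto simp: shabat_polynomial_def)
  define k where "k = order v p"
  have k: "k > 0" using p p0 by (simp add: k_def order_gt_0_iff)
  obtain U r \<epsilon> where U: "open U" "v \<in> U" "U \<subseteq> N" "0 < \<epsilon>"
    and r: "\<And>z. z \<in> U \<Longrightarrow> z \<in> preimage_01 p \<Longrightarrow> \<exists>j<k. \<exists>t. 0 < t \<and> t < \<epsilon> \<and> z = r j t"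
      "\<And>j t. j < k \<Longrightarrow> 0 < t \<Longrightarrow> t < \<epsilon> \<Longrightarrow> r j t \<in> U \<inter> preimage_01 p \<and> poly p (r j t) = of_real (t ^ k)"
      "\<And>j. continuous_on {0<..<\<epsilon>} (r j)"
    unfolding k_def by (rule root_rays[OF p0 p(2) N]) blast
  have "U \<inter> e \<noteq> {}" using U e(2) open_Int_closure_eq_empty by blast
  then obtain z where z: "z \<in> U" "z \<in> e" by blast
  have eS: "e \<subseteq> preimage_01 p" using e(1) by (rule in_components_subset)
  obtain j t where jt: "j < k" "0 < t" "t < \<epsilon>" "z = r j t" using r(1)[of z] z eS by blast
  have sub: "r j ` {0<..<\<epsilon>} \<subseteq> e"
    by (rule ray_in_edge[OF e(1) r(3)]) (use r(2) jt z in auto)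
  show ?thesis
  \<comment> \<open>On a ray with parameter below \<open>\<epsilon>\<close> the value is the
    \<open>k\<close>-th power of the parameter, hence this threshold and the root below.\<close>
  proof (intro exI[of _ "\<epsilon> ^ k"] conjI allI impI)
    fix s :: real assume s: "0 < s \<and> s < \<epsilon> ^ k"
    have "0 < root k s" using s k by simp
    moreover have "root k s < \<epsilon>" using s k U(4) real_root_less_iff[OF k, of s "\<epsilon> ^ k"]
      by (simp add: real_root_power_cancel)
    ultimately have "r j (root k s) \<in> e \<inter> N" "poly p (r j (root k s)) = of_real (root k s ^ k)"
      using r(2)[of j "root k s"] jt sub U(3) by auto
    moreover have "root k s ^ k = s" using s k by simp
    ultimately show "\<exists>z \<in> e \<inter> N. poly p z = of_real s" by metis
  qed (use U in simp)
qed

text \<open>Around two different ends there would be disjoint neighbourhoods, both containing points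
  of \<open>e\<close> with the same small value, against the injectivity of \<open>p\<close> on
  \<open>e\<close>.\<close>

lemma edge_closure_black_unique:
  assumes p: "shabat_polynomial 0 1 p" and e: "e \<in> components (preimage_01 p)"
    and v: "poly p v = 0" "v \<in> closure e" and w: "poly p w = 0" "w \<in> closure e"
  shows "v = w"
proof (rule ccontr)
  assume "v \<noteq> w"
  then obtain M N where MN: "open M" "open N" "v \<in> M" "w \<in> N" "M \<inter> N = {}" by (metis hausdorff)
  obtain \<delta> where \<delta>: "\<delta> > 0" "\<And>t. 0 < t \<Longrightarrow> t < \<delta> \<Longrightarrow> \<exists>z \<in> e \<inter> M. poly p z = of_real t"
    using edge_near_root[OF p v(1) e v(2) MN(1,3)] by blast
  obtain \<gamma> where \<gamma>: "\<gamma> > 0" "\<And>t. 0 < t \<Longrightarrow> t < \<gamma> \<Longrightarrow> \<exists>z \<in> e \<inter> N. poly p z = of_real t"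
    using edge_near_root[OF p w(1) e w(2) MN(2,4)] by blast
  define t where "t = min \<delta> \<gamma> / 2"
  have t: "0 < t" "t < \<delta>" "t < \<gamma>" using \<delta> \<gamma> by (auto simp: t_def)
  obtain y z where "y \<in> e \<inter> M" "z \<in> e \<inter> N" "poly p y = poly p z" using \<delta>(2) \<gamma>(2) t by metis
  then show False using edge_bij(1)[OF p e] MN(5) by (auto dest: inj_onD)
qed

text \<open>The rays at \<open>v\<close> correspond to the edges at \<open>v\<close>: each ray is
  connected, and an edge that accumulates at \<open>v\<close> contains one. The common factor
  \<open>a\<close> of the directions is the phase of \<open>1 / g v\<close>.\<close>

lemma edges_at_root:
  assumes p: "shabat_polynomial 0 1 p" and v: "poly p v = 0"
  defines "k \<equiv> order v p"
  obtains E a where "a \<noteq> 0" "bij_betw E {..<k} {e \<in> components (preimage_01 p). v \<in> closure e}"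
    "\<And>j. j < k \<Longrightarrow> tangent_direction v (E j) = a * cis (2 * pi * real j / real k)"
    "\<And>j. j < k \<Longrightarrow> ((\<lambda>z. sgn (z - v)) \<longlongrightarrow> tangent_direction v (E j)) (at v within E j)"
proof -
  define u where "u j = cis (2 * pi * real j / real k)" for j
  have p0: "p \<noteq> 0" using p by (auto simp: shabat_polynomial_def)
  have k: "k > 0" using v p0 by (simp add: k_def order_gt_0_iff)
  have u0: "u j \<noteq> 0" for j by (simp add: u_def)
  have injr: "i = j" if "u i = u j" "i < k" "j < k" for i j
    using Complex.bij_betw_roots_unity[OF k] that unfolding bij_betw_def u_def by (auto dest: inj_onD)
  obtain U r g \<epsilon> where U: "open U" "v \<in> U" "0 < \<epsilon>" and g: "isCont g v" "g v \<noteq> 0"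
    and r: "\<And>z. z \<in> U \<Longrightarrow> z \<in> preimage_01 p \<Longrightarrow> \<exists>j<k. \<exists>t. 0 < t \<and> t < \<epsilon> \<and> z = r j t"
      "\<And>j t. j < k \<Longrightarrow> 0 < t \<Longrightarrow> t < \<epsilon> \<Longrightarrow> r j t \<in> U \<inter> preimage_01 p \<and> poly p (r j t) = of_real (t ^ k)"
      "\<And>j t. j < k \<Longrightarrow> 0 < t \<Longrightarrow> t < \<epsilon> \<Longrightarrow> (r j t - v) * g (r j t) = of_real t * u j"
      "\<And>j. continuous_on {0<..<\<epsilon>} (r j)" "\<And>j. (r j \<longlongrightarrow> v) (at_right 0)"
    unfolding k_def u_def by (rule root_rays[OF p0 v open_UNIV UNIV_I]) blast
  define E where "E j = connected_component_set (preimage_01 p) (r j (\<epsilon> / 2))" for j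
  have mid: "r j (\<epsilon> / 2) \<in> preimage_01 p" if "j < k" for j using r(2)[of j "\<epsilon> / 2"] U(3) that by simp
  have E: "E j \<in> components (preimage_01 p)" if "j < k" for j
    unfolding E_def using mid[OF that] by (rule componentsI)
  have rE: "r j t \<in> E j" if "j < k" "0 < t" "t < \<epsilon>" for j t
  proof -
    have "r j ` {0<..<\<epsilon>} \<subseteq> E j"
    proof (rule ray_in_edge[OF E[OF that(1)] r(4)])
      show "r j (\<epsilon> / 2) \<in> E j" unfolding E_def using mid[OF that(1)] by simp
    qed (use r(2) that U(3) in auto)
    then show ?thesis using that by auto
  qed
  have Er: "E j = e" if "j < k" "0 < t" "t < \<epsilon>" "e \<in> components (preimage_01 p)" "r j t \<in> e" for j t e
    using components_nonoverlap[OF E[OF that(1)] that(4)] rE[OF that(1-3)] that(5) by blast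
  have vE: "v \<in> closure (E j)" if "j < k" for j
  proof (rule Lim_in_closed_set[OF closed_closure _ _ r(5)])
    have "eventually (\<lambda>t. t \<in> {0<..<\<epsilon>}) (at_right 0)" using eventually_at_right_real[OF U(3)] .
    then show "eventually (\<lambda>t. r j t \<in> closure (E j)) (at_right 0)"
      by eventually_elim (use rE[OF that] closure_subset in auto)
  qed simp
  have inj: "i = j" if ij: "i < k" "j < k" "E i = E j" for i j
  proof -
    have h: "0 < \<epsilon> / 2" "\<epsilon> / 2 < \<epsilon>" using U(3) by auto
    \<comment> \<open>At equal parameters two rays have equal values, so injectivity of
      \<open>p\<close> on a common edge would make the rays meet there.\<close>
    have "r i (\<epsilon> / 2) = r j (\<epsilon> / 2)"
      by (rule inj_onD[OF edge_bij(1)[OF p E[OF ij(1)]]])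
        (use rE[OF ij(1) h] rE[OF ij(2) h] ij(3) r(2)[OF ij(1) h] r(2)[OF ij(2) h] in simp_all)
    then have "u i = u j" using r(3)[OF ij(1) h] r(3)[OF ij(2) h] h by auto
    then show ?thesis using injr ij by blast
  qed
  have "bij_betw E {..<k} {e \<in> components (preimage_01 p). v \<in> closure e}"
    unfolding bij_betw_def
  proof (intro conjI subset_antisym subsetI)
    show "inj_on E {..<k}" using inj by (auto simp: inj_on_def)
    fix e assume e: "e \<in> {e \<in> components (preimage_01 p). v \<in> closure e}"
    then have "U \<inter> e \<noteq> {}" using U open_Int_closure_eq_empty by blast
    then obtain z where z: "z \<in> U" "z \<in> e" by blast
    have "e \<subseteq> preimage_01 p" using e in_components_subset by blast
    then obtain j t where jt: "j < k" "0 < t" "t < \<epsilon>" "z = r j t" using r(1)[of z] z by blast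
    then have "E j = e" using Er e z by blast
    then show "e \<in> E ` {..<k}" using jt(1) by blast
  qed (use E vE in auto)
  moreover have "tangent_direction v (E j) = sgn (inverse (g v)) * u j \<and>
      ((\<lambda>z. sgn (z - v)) \<longlongrightarrow> tangent_direction v (E j)) (at v within E j)" if j: "j < k" for j
  proof -
    \<comment> \<open>The vertex has value 0 and lies outside the edge, so it is a limit point of
      the edge and the \<open>Lim\<close> in \<open>tangent_direction\<close> is taken along a
      nontrivial filter.\<close>
    have "v \<notin> E j"
      using in_components_subset[OF E[OF j]] v by (auto simp: preimage_01_def open_segment_def)
    then have "v islimpt E j" using vE[OF j] by (simp add: closure_def)
    then have nt: "\<not> trivial_limit (at v within E j)" by (simp add: trivial_limit_within)
    have "eventually (\<lambda>z. z \<in> U) (at v within E j)" using U eventually_at_topological by blast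
    moreover have "eventually (\<lambda>z. z \<in> E j) (at v within E j)" by (simp add: eventually_at_filter)
    ultimately have "eventually (\<lambda>z. sgn (inverse (g z)) * u j = sgn (z - v)) (at v within E j)"
    proof eventually_elim
      case (elim z)
      then obtain i t where it: "i < k" "0 < t" "t < \<epsilon>" "z = r i t"
        using r(1)[of z] in_components_subset[OF E[OF j]] by blast
      \<comment> \<open>Near \<open>v\<close> the edge consists of its own ray only, so the phase of
        \<open>z - v\<close> is exactly that of \<open>u j / g z\<close>.\<close>
      then have "i = j" using Er[of i t "E j"] E[OF j] elim(2) inj j by blast
      then have *: "(z - v) * g z = of_real t * u j" using r(3)[OF j] it by simp
      then have "g z \<noteq> 0" using u0 it(2) by auto
      with * have "z - v = of_real t * (inverse (g z) * u j)" by (simp add: field_simps)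
      then show ?case using it(2) by (simp add: sgn_mult sgn_of_real) (simp add: sgn_eq u_def)
    qed
    moreover have "((\<lambda>z. sgn (inverse (g z)) * u j) \<longlongrightarrow> sgn (inverse (g v)) * u j) (at v within E j)"
      using g by (intro tendsto_intros) (auto simp: isCont_def intro: tendsto_within_subset)
    ultimately have "((\<lambda>z. sgn (z - v)) \<longlongrightarrow> sgn (inverse (g v)) * u j) (at v within E j)"
      using Lim_transform_eventually by fast
    with tendsto_Lim[OF nt this] show ?thesis by (simp add: tangent_direction_def)
  qed
  moreover have "sgn (inverse (g v)) \<noteq> 0" using g(2) by (simp add: sgn_zero_iff)
  ultimately show thesis using that unfolding u_def by blast
qed

subsection \<open>The tree of a Shabat polynomial\<close>

lemma Arg2pi_cis: "0 \<le> x \<Longrightarrow> x < 2 * pi \<Longrightarrow> Arg2pi (cis x) = x"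
  unfolding cis_conv_exp by (rule Arg2pi_unique[of 1]) simp_all

text \<open>The quotient of the directions is \<open>cis (2 * pi * y)\<close> with \<open>y\<close>
  between -1 and 1, and a full turn is added when \<open>y\<close> is negative. For
  \<open>i = j\<close> the convention in \<open>ccw_angle\<close> gives a full turn, in agreement
  with \<open>j + k - i = k\<close>.\<close>

lemma ccw_angle_roots_unity:
  assumes "a \<noteq> 0" "i < k" "j < k"
  shows "ccw_angle (a * cis (2 * pi * real i / real k)) (a * cis (2 * pi * real j / real k)) =
    2 * pi * real (if i < j then j - i else j + k - i) / real k"
proof -
  define y where "y = (real j - real i) / real k"
  have y: "y < 1" "- 1 < y" "y < 0 \<longleftrightarrow> j < i" "0 < y \<longleftrightarrow> i < j"
    using assms by (auto simp: y_def field_simps)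
  have "(a * cis (2 * pi * real j / real k)) / (a * cis (2 * pi * real i / real k)) = cis (2 * pi * y)"
    using assms(1) by (simp add: cis_divide y_def right_diff_distrib diff_divide_distrib)
  then have ccw: "ccw_angle (a * cis (2 * pi * real i / real k)) (a * cis (2 * pi * real j / real k)) =
      (if Arg2pi (cis (2 * pi * y)) = 0 then 2 * pi else Arg2pi (cis (2 * pi * y)))"
    by (simp add: ccw_angle_def)
  consider "i < j" | "i = j" | "j < i" by linarith
  then show ?thesis
  proof cases
    case 1
    then have "Arg2pi (cis (2 * pi * y)) = 2 * pi * y" using y by (intro Arg2pi_cis) auto
    moreover have "2 * pi * y \<noteq> 0" using y 1 by simp
    ultimately show ?thesis using ccw 1 by (simp add: y_def of_nat_diff)
  next
    case 2
    then have "y = 0" by (simp add: y_def)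
    then show ?thesis using ccw assms Arg2pi_cis[of 0] 2 by simp
  next
    case 3
    have *: "2 * pi * y + 2 * pi = 2 * pi * (y + 1)" by (simp add: algebra_simps)
    have "cis (2 * pi * (y + 1)) = cis (2 * pi * y)" unfolding *[symmetric] by (simp add: complex_eq_iff)
    moreover have "Arg2pi (cis (2 * pi * (y + 1))) = 2 * pi * (y + 1)"
      using y 3 by (intro Arg2pi_cis) auto
    moreover have "2 * pi * (y + 1) \<noteq> 0" using y(2) by simp
    ultimately have "ccw_angle (a * cis (2 * pi * real i / real k)) (a * cis (2 * pi * real j / real k)) =
        2 * pi * (y + 1)" using ccw by simp
    also have "y + 1 = real (j + k - i) / real k" using assms 3 by (simp add: y_def of_nat_diff field_simps)
    finally show ?thesis using 3 by simp
  qed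
qed

text \<open>In units of \<open>2 * pi / k\<close> the angles are the integers
  \<open>m i \<ge> 1\<close>, and the value 1 is attained only at the cyclic successor; for
  \<open>k = 1\<close> this is the edge itself, after a full turn.\<close>

lemma arg_min_ccw_angle:
  assumes a: "a \<noteq> 0" and E: "bij_betw E {..<k} A"
    and \<tau>: "\<And>j. j < k \<Longrightarrow> \<tau> (E j) = a * cis (2 * pi * real j / real k)" and j: "j < k"
  shows "arg_min_on (\<lambda>f. ccw_angle (\<tau> (E j)) (\<tau> f)) A = E (Suc j mod k)"
proof -
  define m where "m i = (if j < i then i - j else i + k - j)" for i
  have val: "ccw_angle (\<tau> (E j)) (\<tau> (E i)) = 2 * pi * real (m i) / real k" if "i < k" for i
    using ccw_angle_roots_unity[OF a j that] \<tau> j that by (simp add: m_def)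
  have k: "k > 0" using j by simp
  have A: "\<exists>i<k. f = E i" if "f \<in> A" for f using E that by (auto simp: bij_betw_def)
  have m1: "m (Suc j mod k) = 1" using j by (auto simp: m_def mod_Suc)
  have mge: "1 \<le> m i" if "i < k" for i using j that by (auto simp: m_def)
  have meq: "i = Suc j mod k" if "m i \<le> 1" "i < k" for i
    using that j by (auto simp: m_def mod_Suc split: if_splits)
  have S: "Suc j mod k < k" using k by simp
  show ?thesis unfolding arg_min_on_def
  proof (rule arg_minI[where Q = "\<lambda>f. f = E (Suc j mod k)"])
    show "E (Suc j mod k) \<in> A" using E S by (auto simp: bij_betw_def)
    fix f assume "f \<in> A"
    then obtain i where i: "i < k" "f = E i" using A by blast
    show "\<not> ccw_angle (\<tau> (E j)) (\<tau> f) < ccw_angle (\<tau> (E j)) (\<tau> (E (Suc j mod k)))"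
      using mge[OF i(1)] k by (simp add: val i S m1 field_simps)
  next
    fix f assume f: "f \<in> A" "\<forall>y. y \<in> A \<longrightarrow> \<not> ccw_angle (\<tau> (E j)) (\<tau> y) < ccw_angle (\<tau> (E j)) (\<tau> f)"
    then obtain i where i: "i < k" "f = E i" using A by blast
    have "E (Suc j mod k) \<in> A" using E S by (auto simp: bij_betw_def)
    then have "ccw_angle (\<tau> (E j)) (\<tau> f) \<le> ccw_angle (\<tau> (E j)) (\<tau> (E (Suc j mod k)))"
      using f(2) by (simp add: not_less)
    then have "m i \<le> 1" using k by (simp add: val i S m1 field_simps)
    then show "f = E (Suc j mod k)" using meq i by simp
  qed
qed

text \<open>Passing from \<open>p\<close> to \<open>1 - p\<close> exchanges the colours and keeps
  the edges, so facts about black vertices carry over to white ones.\<close>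

lemma shabat_one_minus: "shabat_polynomial 0 1 p \<Longrightarrow> shabat_polynomial 0 1 (1 - p)"
proof -
  assume p: "shabat_polynomial 0 1 p"
  have "degree (1 - p) = degree p"
  proof -
    have "degree (- p + 1) = degree (- p)"
      by (rule degree_add_eq_left) (use p in \<open>simp add: shabat_polynomial_def\<close>)
    then show ?thesis by simp
  qed
  moreover have "pderiv (1 - p) = - pderiv p" by (simp add: pderiv_diff)
  ultimately show ?thesis using p
    by (auto simp: shabat_polynomial_def critical_values_def image_subset_iff)
qed

lemma preimage_01_one_minus: "preimage_01 (1 - p) = preimage_01 p"
proof -
  have *: "z \<in> complex_of_real ` {0<..<1} \<Longrightarrow> 1 - z \<in> complex_of_real ` {0<..<1}" for z
    by (auto intro!: image_eqI[of "1 - complex_of_real t" of_real "1 - t" for t])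
  have "1 - z \<in> complex_of_real ` {0<..<1} \<longleftrightarrow> z \<in> complex_of_real ` {0<..<1}" for z
    using *[of z] *[of "1 - z"] by auto
  then show ?thesis by (simp add: preimage_01_def open_segment_01)
qed

section \<open>Degrees, ends and rotation of the preimage graph\<close>

lemma shabat_tree_simps:
  "black (shabat_tree 0 1 p) = {z. poly p z = 0}"
  "white (shabat_tree 0 1 p) = {z. poly p z = 1}"
  "edges (shabat_tree 0 1 p) = components (preimage_01 p)"
  "inc (shabat_tree 0 1 p) v e \<longleftrightarrow> v \<in> closure e"
  "edges_at (shabat_tree 0 1 p) v = {e \<in> components (preimage_01 p). v \<in> closure e}"
  "rot (shabat_tree 0 1 p) v e =
     arg_min_on (\<lambda>f. ccw_angle (tangent_direction v e) (tangent_direction v f)) (edges_at (shabat_tree 0 1 p) v)"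
  unfolding shabat_tree_def Let_def preimage_01_def edges_at_def by simp_all

lemma shabat_tree_edges_at:
  assumes p: "shabat_polynomial 0 1 p" and v: "v \<in> verts (shabat_tree 0 1 p)"
  obtains k E a where "0 < k" "a \<noteq> 0" "bij_betw E {..<k} (edges_at (shabat_tree 0 1 p) v)"
    "\<And>j. j < k \<Longrightarrow> tangent_direction v (E j) = a * cis (2 * pi * real j / real k)"
    "\<And>j. j < k \<Longrightarrow> rot (shabat_tree 0 1 p) v (E j) = E (Suc j mod k)"
    "\<And>e. e \<in> edges_at (shabat_tree 0 1 p) v \<Longrightarrow>
       ((\<lambda>z. sgn (z - v)) \<longlongrightarrow> tangent_direction v e) (at v within e)"
    "poly p v = 0 \<Longrightarrow> k = order v p" "poly p v = 1 \<Longrightarrow> k = order v (1 - p)"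
proof -
  \<comment> \<open>The polynomial that vanishes at \<open>v\<close>, whichever colour
    \<open>v\<close> has.\<close>
  define q where "q = (if poly p v = 0 then p else 1 - p)"
  have q: "shabat_polynomial 0 1 q" using p shabat_one_minus by (simp add: q_def)
  have qv: "poly q v = 0" using v by (auto simp: q_def verts_def shabat_tree_simps)
  have pre: "preimage_01 q = preimage_01 p" by (simp add: q_def preimage_01_one_minus)
  obtain E a where E: "a \<noteq> 0"
      "bij_betw E {..<order v q} (edges_at (shabat_tree 0 1 p) v)"
      "\<And>j. j < order v q \<Longrightarrow> tangent_direction v (E j) = a * cis (2 * pi * real j / real (order v q))"
    and lim: "\<And>j. j < order v q \<Longrightarrow>
      ((\<lambda>z. sgn (z - v)) \<longlongrightarrow> tangent_direction v (E j)) (at v within E j)"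
    by (rule edges_at_root[OF q qv]) (auto simp: pre shabat_tree_simps)
  have "q \<noteq> 0" using q by (auto simp: shabat_polynomial_def)
  then have "0 < order v q" using qv by (simp add: order_gt_0_iff)
  moreover have "rot (shabat_tree 0 1 p) v (E j) = E (Suc j mod order v q)" if "j < order v q" for j
    unfolding shabat_tree_simps(6) by (rule arg_min_ccw_angle[OF E that])
  moreover have "((\<lambda>z. sgn (z - v)) \<longlongrightarrow> tangent_direction v e) (at v within e)"
    if "e \<in> edges_at (shabat_tree 0 1 p) v" for e
  proof -
    have "e \<in> E ` {..<order v q}" using that E(2) by (simp add: bij_betw_def)
    then show ?thesis using lim by auto
  qed
  ultimately show thesis using that[of "order v q" a E] E by (auto simp: q_def)
qed

lemma vdegree_shabat_tree:
  assumes p: "shabat_polynomial 0 1 p"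
  shows "poly p v = 0 \<Longrightarrow> vdegree (shabat_tree 0 1 p) v = order v p"
    and "poly p v = 1 \<Longrightarrow> vdegree (shabat_tree 0 1 p) v = order v (1 - p)"
proof -
  have "vdegree (shabat_tree 0 1 p) v = (if poly p v = 0 then order v p else order v (1 - p))"
    if "v \<in> verts (shabat_tree 0 1 p)"
  proof (rule shabat_tree_edges_at[OF p that])
    fix k and E :: "nat \<Rightarrow> complex set"
    assume "bij_betw E {..<k} (edges_at (shabat_tree 0 1 p) v)"
      and k: "poly p v = 0 \<Longrightarrow> k = order v p" "poly p v = 1 \<Longrightarrow> k = order v (1 - p)"
    then have "vdegree (shabat_tree 0 1 p) v = k"
      unfolding vdegree_def by (metis bij_betw_same_card card_lessThan)
    with that k show ?thesis by (auto simp: verts_def shabat_tree_simps)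
  qed
  then show "poly p v = 0 \<Longrightarrow> vdegree (shabat_tree 0 1 p) v = order v p"
    and "poly p v = 1 \<Longrightarrow> vdegree (shabat_tree 0 1 p) v = order v (1 - p)"
    by (auto simp: verts_def shabat_tree_simps)
qed

lemma edge_end_unique:
  assumes p: "shabat_polynomial 0 1 p" and e: "e \<in> components (preimage_01 p)"
  shows "\<exists>!v. poly p v = 0 \<and> v \<in> closure e" "\<exists>!v. poly p v = 1 \<and> v \<in> closure e"
proof -
  have *: "\<exists>!v. poly q v = 0 \<and> v \<in> closure e"
    if "shabat_polynomial 0 1 q" "e \<in> components (preimage_01 q)" for q
    using edge_closure_black[OF that] edge_closure_black_unique[OF that] by blast
  show "\<exists>!v. poly p v = 0 \<and> v \<in> closure e" using *[OF p e] .
  show "\<exists>!v. poly p v = 1 \<and> v \<in> closure e"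
    using *[OF shabat_one_minus[OF p]] e by (simp add: preimage_01_one_minus eq_commute[of 1])
qed

lemma plane_graph_shabat_tree:
  assumes p: "shabat_polynomial 0 1 p"
  shows "plane_graph (shabat_tree 0 1 p)"
  unfolding plane_graph_def
proof (intro conjI ballI)
  let ?T = "shabat_tree 0 1 p"
  show "black ?T \<inter> white ?T = {}" by (auto simp: shabat_tree_simps)
  show "\<exists>!b. b \<in> black ?T \<and> inc ?T b e" "\<exists>!w. w \<in> white ?T \<and> inc ?T w e" if "e \<in> edges ?T" for e
    using edge_end_unique[OF p, of e] that by (simp_all add: shabat_tree_simps)
  fix v assume v: "v \<in> verts ?T"
  obtain k E where k: "0 < k" and E: "bij_betw E {..<k} (edges_at ?T v)"
      and rot: "\<And>j. j < k \<Longrightarrow> rot ?T v (E j) = E (Suc j mod k)"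
    by (rule shabat_tree_edges_at[OF p v]) blast
  show "finite (edges_at ?T v)" using bij_betw_finite[OF E] by simp
  show "edges_at ?T v \<noteq> {}" using E k by (auto simp: bij_betw_def)
  have pow: "(rot ?T v ^^ i) (E j) = E ((j + i) mod k)" if "j < k" for i j
    by (induction i) (use that k rot in \<open>auto simp: mod_Suc_eq\<close>)
  fix e assume "e \<in> edges_at ?T v"
  then obtain j where j: "j < k" "e = E j" using E by (auto simp: bij_betw_def)
  have "Suc j mod k < k" using k by simp
  then show "rot ?T v e \<in> edges_at ?T v" using j rot E by (auto simp: bij_betw_def)
  fix f assume "f \<in> edges_at ?T v"
  then obtain l where l: "l < k" "f = E l" using E by (auto simp: bij_betw_def)
  \<comment> \<open>Adding \<open>k\<close> keeps the subtraction of natural numbers from being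
    truncated when \<open>l < j\<close>.\<close>
  have "(rot ?T v ^^ (l + k - j)) e = E l" using pow[OF j(1), of "l + k - j"] j l by simp
  then show "\<exists>i. (rot ?T v ^^ i) e = f" using l by blast
qed

text \<open>Edges at \<open>v\<close> have distinct, equally spaced directions, so a turn by one
  spacing identifies the successor. This gives the rotation of a concrete tree without reference to
  the enumeration of its edges.\<close>

lemma rot_shabat_tree_eqI:
  assumes p: "shabat_polynomial 0 1 p" and v: "v \<in> verts (shabat_tree 0 1 p)"
    and ef: "e \<in> edges_at (shabat_tree 0 1 p) v" "f \<in> edges_at (shabat_tree 0 1 p) v"
    and tan: "tangent_direction v f =
      tangent_direction v e * cis (2 * pi / real (vdegree (shabat_tree 0 1 p) v))"
  shows "rot (shabat_tree 0 1 p) v e = f"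
proof (rule shabat_tree_edges_at[OF p v])
  let ?T = "shabat_tree 0 1 p"
  fix k E and a :: complex
  assume k: "0 < k" and a: "a \<noteq> 0" and E: "bij_betw E {..<k} (edges_at ?T v)"
    and td: "\<And>j. j < k \<Longrightarrow> tangent_direction v (E j) = a * cis (2 * pi * real j / real k)"
    and rot: "\<And>j. j < k \<Longrightarrow> rot ?T v (E j) = E (Suc j mod k)"
  have deg: "vdegree ?T v = k" using E unfolding vdegree_def by (metis bij_betw_same_card card_lessThan)
  have "\<exists>i<k. g = E i" if "g \<in> edges_at ?T v" for g using E that by (auto simp: bij_betw_def)
  then obtain i j where ij: "i < k" "e = E i" "j < k" "f = E j" using ef by metis
  have "a * cis (2 * pi * real j / real k) = a * (cis (2 * pi * real i / real k) * cis (2 * pi / real k))"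
    using tan td[OF ij(1)] td[OF ij(3)] unfolding deg ij(2,4) by (simp add: mult.assoc)
  then have "cis (2 * pi * real j / real k) = cis (2 * pi * real i / real k) * cis (2 * pi / real k)"
    using a by simp
  also have "\<dots> = cis (2 * pi * real (Suc i) / real k)" 
    by (simp add: cis_mult add_divide_distrib[symmetric] algebra_simps)
  also have "\<dots> = cis (2 * pi * real (Suc i mod k) / real k)"
  proof (cases "Suc i = k")
    case True
    then show ?thesis using k by (simp del: of_nat_Suc)
  next
    case False
    then show ?thesis using ij(1) by simp
  qed
  finally have "j = Suc i mod k"
    using Complex.bij_betw_roots_unity[OF k] ij k unfolding bij_betw_def by (auto dest: inj_onD)
  then show "rot ?T v e = f" using rot ij by simp
qed

subsection \<open>The tree with alternating degrees around a white vertex\<close>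

text \<open>Distinct edges at \<open>w\<close> have distinct black ends, since two parallel edges
  form a cycle. There are as many black vertices as edges at \<open>w\<close>, so every black vertex
  is such an end.\<close>

lemma centered_tree:
  assumes T: "bicolored_plane_tree T" and w: "w \<in> white T" "edges_at T w \<noteq> {}"
    and card: "card (black T) = vdegree T w"
    and leaf: "\<And>u. u \<in> white T \<Longrightarrow> u \<noteq> w \<Longrightarrow> vdegree T u = 1"
  shows "centered T w"
proof -
  have fin: "finite (verts T)" "finite (edges T)" "\<And>v. finite (edges_at T v)"
    using T by (auto simp: bicolored_plane_tree_def edges_at_def)
  have bend: "black_end T e \<in> black T \<and> inc T (black_end T e) e" if "e \<in> edges T" for e
    unfolding black_end_def by (rule theI') (use T that in \<open>auto simp: bicolored_plane_tree_def\<close>)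
  have inj: "inj_on (black_end T) (edges_at T w)"
  proof (rule inj_onI, rule ccontr)
    fix e f assume *: "e \<in> edges_at T w" "f \<in> edges_at T w" "black_end T e = black_end T f" "e \<noteq> f"
    let ?b = "black_end T e"
    have be: "?b \<in> black T" "inc T ?b e" "inc T ?b f"
      using bend[of e] bend[of f] * by (auto simp: edges_at_def)
    have "?b \<noteq> w" using be(1) w(1) T by (auto simp: bicolored_plane_tree_def)
    then have "graph_cycle T [?b, w] [e, f]"
      using * be w(1) by (auto simp: graph_cycle_def edges_at_def verts_def less_Suc_eq)
    then show False using T by (auto simp: bicolored_plane_tree_def)
  qed
  have sub: "black_end T ` edges_at T w \<subseteq> black T" using bend by (auto simp: edges_at_def)
  have im: "black_end T ` edges_at T w = black T"
  proof (rule card_subset_eq[OF _ sub])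
    show "card (black_end T ` edges_at T w) = card (black T)"
      using card_image[OF inj] card by (simp add: vdegree_def)
  qed (use fin in \<open>simp add: verts_def\<close>)
  have ne: "edges_at T v \<noteq> {}" if "v \<in> verts T" for v
  proof (cases "v \<in> black T")
    case True
    then obtain e where "e \<in> edges_at T w" "black_end T e = v" unfolding im[symmetric] by auto
    then have "e \<in> edges_at T v" using bend[of e] by (auto simp: edges_at_def)
    then show ?thesis by blast
  next
    case False
    then have "v \<in> white T" using that by (simp add: verts_def)
    then have "v = w \<or> vdegree T v = 1" using leaf by blast
    then show ?thesis using w(2) by (auto simp: vdegree_def)
  qed
  have "plane_graph T" unfolding plane_graph_def
    using T fin ne unfolding bicolored_plane_tree_def by blast
  then show ?thesis using w(1) inj im leaf by (simp add: centered_def)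
qed

text \<open>The vertex \<open>w\<close> accounts for the entry \<open>d\<close>, which leaves only
  ones. It turns the white part of a passport into the statement that the other white vertices are
  leaves.\<close>

lemma image_mset_eq_1:
  assumes "image_mset f (mset_set W) = {#d#} + replicate_mset m 1" "finite W" "w \<in> W" "f w = d"
    "u \<in> W" "u \<noteq> w"
  shows "f u = 1"
proof -
  have "mset_set W = add_mset w (mset_set (W - {w}))" using assms by (simp add: mset_set.remove)
  then have "image_mset f (mset_set (W - {w})) = replicate_mset m 1" using assms(1,4) by simp
  moreover have "f u \<in># image_mset f (mset_set (W - {w}))" using assms by auto
  ultimately show ?thesis by (metis in_replicate_mset)
qed

text \<open>The segment is connected, so it lies in a single edge, and both of its end points are in
  the closure.\<close>

lemma segment_in_edge:
  assumes p: "shabat_polynomial 0 1 p" and v: "v \<in> verts (shabat_tree 0 1 p)"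
    and d: "norm d = 1" and l: "0 < l"
    and seg: "\<And>t. 0 < t \<Longrightarrow> t < l \<Longrightarrow> v + of_real t * d \<in> preimage_01 p"
  obtains e where "e \<in> components (preimage_01 p)" "v \<in> closure e" "v + of_real l * d \<in> closure e"
    "tangent_direction v e = d"
proof -
  let ?r = "\<lambda>t. v + complex_of_real t * d"
  define e where "e = connected_component_set (preimage_01 p) (?r (l / 2))"
  have h: "?r (l / 2) \<in> preimage_01 p" using seg[of "l / 2"] l by simp
  then have e: "e \<in> components (preimage_01 p)" unfolding e_def by (rule componentsI)
  have sub: "?r ` {0<..<l} \<subseteq> e"
  proof (rule ray_in_edge[OF e])
    show "continuous_on {0<..<l} ?r" by (intro continuous_intros)
    show "?r (l / 2) \<in> e" using h by (simp add: e_def)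
  qed (use seg l in auto)
  have re: "?r t \<in> e" if "0 < t" "t < l" for t
    by (rule subsetD[OF sub], rule imageI) (use that in simp)
  have ev0: "eventually (\<lambda>t. t \<in> {0<..<l}) (at_right 0)" using eventually_at_right_real[OF l] .
  have evl: "eventually (\<lambda>t. t \<in> {0<..<l}) (at_left l)" using eventually_at_left_real[OF l] .
  have "(?r \<longlongrightarrow> v + of_real 0 * d) (at_right 0)" by (intro tendsto_intros)
  then have lim0: "(?r \<longlongrightarrow> v) (at_right 0)" by simp
  have liml: "(?r \<longlongrightarrow> ?r l) (at_left l)" by (intro tendsto_intros)
  have v_cl: "v \<in> closure e"
  proof (rule Lim_in_closed_set[OF closed_closure _ _ lim0])
    show "eventually (\<lambda>t. ?r t \<in> closure e) (at_right 0)"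
      by (rule eventually_mono[OF ev0]) (use re closure_subset in auto)
  qed simp
  have l_cl: "?r l \<in> closure e"
  proof (rule Lim_in_closed_set[OF closed_closure _ _ liml])
    show "eventually (\<lambda>t. ?r t \<in> closure e) (at_left l)"
      by (rule eventually_mono[OF evl]) (use re closure_subset in auto)
  qed simp
  have "e \<in> edges_at (shabat_tree 0 1 p) v" using e v_cl by (simp add: shabat_tree_simps)
  note e_at = this
  \<comment> \<open>The limit along the whole edge is already known to exist, so it may be computed
    along the segment, where the direction is constantly \<open>d\<close>.\<close>
  have lim: "((\<lambda>z. sgn (z - v)) \<longlongrightarrow> tangent_direction v e) (at v within e)"
    by (rule shabat_tree_edges_at[OF p v]) (use e_at in blast)
  have d0: "d \<noteq> 0" "sgn d = d" using d by (auto simp: sgn_div_norm)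
  have "filterlim ?r (at v within e) (at_right 0)"
    unfolding filterlim_at using lim0
    by (auto intro!: eventually_mono[OF ev0] simp: re d0)
  then have "((\<lambda>t. sgn (?r t - v)) \<longlongrightarrow> tangent_direction v e) (at_right 0)"
    by (rule filterlim_compose[OF lim])
  moreover have "((\<lambda>t. sgn (?r t - v)) \<longlongrightarrow> d) (at_right 0)"
    by (rule tendsto_eventually, rule eventually_mono[OF ev0])
      (use d in \<open>auto simp: sgn_mult sgn_of_real d0\<close>)
  ultimately have "tangent_direction v e = d" by (intro tendsto_unique[of "at_right (0::real)"]) auto
  with that e v_cl l_cl show thesis by blast
qed

text \<open>By \<open>1 - y \<le> exp (- y)\<close> and \<open>1 + x < exp x\<close> for positive
  \<open>x\<close>, the two powers are bounded by \<open>exp (- m * y)\<close> and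
  \<open>exp (m * y)\<close>, the second bound being strict.\<close>

lemma one_minus_power_mult_less_one:
  fixes y :: real
  assumes "0 < y" "y < 1" "0 < m" "0 < n"
  shows "0 < (1 - y) ^ m * (1 + real m / real n * y) ^ n" "(1 - y) ^ m * (1 + real m / real n * y) ^ n < 1"
proof -
  let ?x = "real m / real n * y"
  have x: "0 < ?x" using assms by simp
  then show "0 < (1 - y) ^ m * (1 + ?x) ^ n"
    using assms by (intro mult_pos_pos zero_less_power add_pos_pos) auto
  have "1 + ?x = exp (ln (1 + ?x))" using x by simp
  also have "\<dots> < exp ?x" using ln_add_one_self_less_self[OF x] by (simp only: exp_less_cancel_iff)
  finally have "(1 + ?x) ^ n < exp ?x ^ n" using x assms by (intro power_strict_mono) auto
  also have "exp ?x ^ n = exp (real m * y)" using assms by (simp flip: exp_of_nat_mult)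
  finally have 1: "(1 + ?x) ^ n < exp (real m * y)" .
  have "(1 - y) ^ m \<le> exp (- y) ^ m"
    using assms exp_ge_add_one_self[of "- y"] by (intro power_mono) auto
  also have "\<dots> = exp (- (real m * y))" by (simp flip: exp_of_nat_mult)
  finally have 2: "(1 - y) ^ m \<le> exp (- (real m * y))" .
  have "(1 - y) ^ m * (1 + ?x) ^ n \<le> exp (- (real m * y)) * (1 + ?x) ^ n"
    using 2 x by (intro mult_right_mono) auto
  also have "\<dots> < exp (- (real m * y)) * exp (real m * y)" using 1 by simp
  finally show "(1 - y) ^ m * (1 + ?x) ^ n < 1" by (simp flip: exp_add)
qed

lemma order_power: "p \<noteq> 0 \<Longrightarrow> order a (p ^ n) = n * order a (p :: 'a::idom poly)"
  by (induction n) (simp_all add: order_mult)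

lemma order_eq_1:
  fixes p :: "'a::field_char_0 poly"
  assumes "poly p a = 0" "poly (pderiv p) a \<noteq> 0"
  shows "order a p = 1"
proof -
  have "p \<noteq> 0" using assms by auto
  then show ?thesis using order_pderiv[of p a] assms order_0I by simp
qed

text \<open>This is \<open>R \<circ> Q\<close>, normalised so that both factors take the value 1 at the origin.\<close>

definition cross_poly :: "nat \<Rightarrow> nat \<Rightarrow> complex poly" where
  "cross_poly r s = [:1, 0, -1:] ^ r * [:1, 0, of_nat r / of_nat s:] ^ s"

lemma poly_cross_poly:
  "poly (cross_poly r s) z = (1 - z\<^sup>2) ^ r * (1 + of_nat r / of_nat s * z\<^sup>2) ^ s"
  by (simp add: cross_poly_def poly_power power2_eq_square algebra_simps)

lemma cross_poly_eq_pcompose: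
  assumes "0 < r" "0 < s"
  shows "pcompose (smult ((-1) ^ r * (of_nat r / of_nat s) ^ s)
      ([:-1, 1:] ^ r * [:of_nat s / of_nat r, 1:] ^ s)) (monom 1 2) = cross_poly r s"
proof -
  have "poly (pcompose (smult ((-1) ^ r * (of_nat r / of_nat s) ^ s)
      ([:-1, 1:] ^ r * [:of_nat s / of_nat r, 1:] ^ s)) (monom 1 2)) z = poly (cross_poly r s) z" for z :: complex
  proof -
    \<comment> \<open>The constants are absorbed into the factors: \<open>(-1) ^ r\<close> into the
      first power, \<open>(r / s) ^ s\<close> into the second.\<close>
    have "(-1) ^ r * (of_nat r / of_nat s) ^ s * ((z\<^sup>2 - 1) ^ r * (z\<^sup>2 + of_nat s / of_nat r) ^ s) =
        ((-1) * (z\<^sup>2 - 1)) ^ r * (of_nat r / of_nat s * (z\<^sup>2 + of_nat s / of_nat r)) ^ s"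
      by (simp only: power_mult_distrib mult_ac)
    also have "of_nat r / of_nat s * (z\<^sup>2 + of_nat s / of_nat r) = 1 + of_nat r / of_nat s * z\<^sup>2"
      using assms by (simp add: field_simps)
    finally show ?thesis
      by (simp add: poly_pcompose poly_monom poly_cross_poly poly_power add.commute)
  qed
  then show ?thesis by (simp add: poly_eq_poly_eq_iff[symmetric] fun_eq_iff)
qed

section \<open>Critical points, roots and spokes of the explicit polynomial\<close>

context
  fixes r s :: nat
  assumes r: "0 < r" and s: "0 < s"
begin

private abbreviation "F \<equiv> cross_poly r s"
private abbreviation "A \<equiv> [:1, 0, -1 :: complex:]"
private abbreviation "B \<equiv> [:1, 0, of_nat r / of_nat s :: complex:]"

text \<open>The coefficient \<open>r / s\<close> in \<open>B\<close> is what makes the terms linear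
  in \<open>z\<close> cancel. The remaining cube accounts for the white vertex of degree 4 at the
  origin; all other critical points are roots.\<close>

lemma pderiv_cross_poly:
  "pderiv F = smult (- 2 * of_nat r * (of_nat r + of_nat s) / of_nat s) (A ^ (r - 1) * B ^ (s - 1) * monom 1 3)"
proof -
  have "poly (pderiv F) z =
      poly (smult (- 2 * of_nat r * (of_nat r + of_nat s) / of_nat s) (A ^ (r - 1) * B ^ (s - 1) * monom 1 3)) z"
    for z
  proof -
    have *: "poly A z ^ r = poly A z ^ (r - 1) * poly A z" "poly B z ^ s = poly B z ^ (s - 1) * poly B z"
      using r s by (simp_all add: power_eq_if)
    have "poly (pderiv F) z =
        of_nat s * poly B z ^ (s - 1) * (2 * of_nat r / of_nat s * z) * poly A z ^ r +
        of_nat r * poly A z ^ (r - 1) * (- 2 * z) * poly B z ^ s"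
      by (simp add: cross_poly_def pderiv_mult pderiv_power pderiv_pCons poly_power algebra_simps)
    also have "\<dots> = poly A z ^ (r - 1) * poly B z ^ (s - 1) *
        (of_nat s * (2 * of_nat r / of_nat s * z) * poly A z + of_nat r * (- 2 * z) * poly B z)"
      unfolding * by (simp only: algebra_simps)
    also have "of_nat s * (2 * of_nat r / of_nat s * z) * poly A z + of_nat r * (- 2 * z) * poly B z =
        - 2 * of_nat r * (of_nat r + of_nat s) / of_nat s * z ^ 3"
      using s by (simp add: field_simps power3_eq_cube)
    finally show ?thesis by (simp add: poly_monom poly_power mult_ac)
  qed
  then show ?thesis by (simp add: poly_eq_poly_eq_iff[symmetric] fun_eq_iff)
qed

lemma degree_cross_poly: "degree F = 2 * r + 2 * s"
  using r s by (simp add: cross_poly_def degree_mult_eq degree_power_eq)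

lemma poly_pderiv_cross_poly_eq_0:
  assumes "poly (pderiv F) z = 0"
  shows "z = 0 \<or> poly F z = 0"
proof -
  have "poly A z = 0 \<or> poly B z = 0 \<or> z = 0"
    using assms r s unfolding pderiv_cross_poly
    by (auto simp: poly_monom poly_power simp flip: of_nat_add)
  then show ?thesis using r s by (auto simp: cross_poly_def poly_power)
qed

lemma shabat_cross_poly: "shabat_polynomial 0 1 F"
proof -
  have "poly F z \<in> {0, 1}" if "poly (pderiv F) z = 0" for z
    using poly_pderiv_cross_poly_eq_0[OF that] by (auto simp: poly_cross_poly)
  then show ?thesis
    unfolding shabat_polynomial_def critical_values_def degree_cross_poly using r by auto
qed

text \<open>At a root only one of \<open>A\<close> and \<open>B\<close> vanishes, and it does so
  simply, so the multiplicity is its exponent. A white point other than 0 is not critical, hence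
  simple.\<close>

lemma order_cross_poly:
  shows "v\<^sup>2 = 1 \<Longrightarrow> order v F = r"
    and "v\<^sup>2 = - (of_nat s / of_nat r) \<Longrightarrow> order v F = s"
    and "order 0 (1 - F) = 4"
    and "poly F v = 1 \<Longrightarrow> v \<noteq> 0 \<Longrightarrow> order v (1 - F) = 1"
proof -
  have AB: "A \<noteq> 0" "B \<noteq> 0" "F \<noteq> 0" by (auto simp: cross_poly_def)
  have ord: "order v F = r * order v A + s * order v B"
    using AB(3) unfolding cross_poly_def by (simp add: order_mult order_power AB(1,2))
  show "order v F = r" if v: "v\<^sup>2 = 1"
  proof -
    have "v \<noteq> 0" using v by auto
    then have "order v A = 1" using v
      by (intro order_eq_1) (auto simp: pderiv_pCons power2_eq_square)
    moreover have "poly B v = 1 + of_nat r / of_nat s"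
      using v by (simp add: power2_eq_square field_simps)
    then have "poly B v \<noteq> 0" using s by (simp only:) (simp add: field_simps flip: of_nat_add)
    then have "order v B = 0" by (rule order_0I)
    ultimately show ?thesis using ord by simp
  qed
  show "order v F = s" if v: "v\<^sup>2 = - (of_nat s / of_nat r)"
  proof -
    have "v \<noteq> 0" using v r s by auto
    moreover have "poly B v = 1 + of_nat r / of_nat s * v\<^sup>2" by (simp add: power2_eq_square)
    then have "poly B v = 0" using v r s by simp
    ultimately have "order v B = 1" using r s by (intro order_eq_1) (auto simp: pderiv_pCons)
    moreover have "poly A v = 1 + of_nat s / of_nat r"
      using v by (simp add: power2_eq_square)
    then have "poly A v \<noteq> 0" using r by (simp only:) (simp add: field_simps flip: of_nat_add)
    then have "order v A = 0" by (rule order_0I)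
    ultimately show ?thesis using ord by simp
  qed
  have one: "1 - F \<noteq> 0" using shabat_one_minus[OF shabat_cross_poly] by (auto simp: shabat_polynomial_def)
  have pd: "pderiv (1 - F) = - pderiv F" by (simp add: pderiv_diff)
  have c: "- 2 * of_nat r * (of_nat r + of_nat s) / of_nat s \<noteq> (0 :: complex)"
    using r s by (simp flip: of_nat_add)
  have "order 0 (A ^ (r - 1) * B ^ (s - 1) * monom 1 3) =
      order 0 (A ^ (r - 1) * B ^ (s - 1)) + order 0 (monom (1::complex) 3)"
    by (rule order_mult) (auto simp: monom_eq_0_iff)
  moreover have "order 0 (A ^ (r - 1) * B ^ (s - 1)) = 0" by (rule order_0I) (simp add: poly_power)
  ultimately have "order 0 (pderiv (1 - F)) = 3"
    unfolding pd order_uminus pderiv_cross_poly order_smult[OF c] by simp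
  \<comment> \<open>\<open>1 - F\<close> vanishes at 0, so its order there exceeds that of its
    derivative by one.\<close>
  then show "order 0 (1 - F) = 4" using order_pderiv[OF one, of 0] by (simp add: poly_cross_poly)
  show "order v (1 - F) = 1" if "poly F v = 1" "v \<noteq> 0"
    by (rule order_eq_1) (use that poly_pderiv_cross_poly_eq_0[of v] in \<open>auto simp: pd\<close>)
qed

definition \<rho> :: real where "\<rho> = sqrt (real s / real r)"

text \<open>The roots in counterclockwise order: \<open>1\<close>, \<open>\<i> * \<rho>\<close>,
  \<open>-1\<close>, \<open>- \<i> * \<rho>\<close>. The index is unbounded, with period 4, so a
  quarter turn is always \<open>Suc\<close>.\<close>

definition corner :: "nat \<Rightarrow> complex" where
  "corner i = of_real (if even i then 1 else \<rho>) * \<i> ^ i"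

lemma rho: "0 < \<rho>" "\<rho>\<^sup>2 = real s / real r"
  using r s by (simp_all add: \<rho>_def)

lemma corner_sq: "(corner i)\<^sup>2 = (if even i then 1 else - (of_nat s / of_nat r))"
proof -
  have "(corner i)\<^sup>2 = of_real ((if even i then 1 else \<rho>)\<^sup>2) * (\<i>\<^sup>2) ^ i"
    by (simp add: corner_def power_mult_distrib flip: power_mult)
  moreover have "complex_of_real (\<rho>\<^sup>2) = of_nat s / of_nat r" by (simp add: rho)
  ultimately show ?thesis by simp
qed

lemma roots_cross_poly: "{z. poly F z = 0} = corner ` {..<4}"
proof -
  have rho2: "complex_of_real (\<rho>\<^sup>2) = of_nat s / of_nat r" by (simp add: rho)
  have "poly F z = 0 \<longleftrightarrow> z\<^sup>2 = 1\<^sup>2 \<or> z\<^sup>2 = (\<i> * of_real \<rho>)\<^sup>2" for z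
  proof -
    have "poly F z = 0 \<longleftrightarrow> 1 - z\<^sup>2 = 0 \<or> 1 + of_nat r / of_nat s * z\<^sup>2 = 0"
      using r s by (simp add: poly_cross_poly)
    also have "1 + of_nat r / of_nat s * z\<^sup>2 = 0 \<longleftrightarrow> z\<^sup>2 = - (of_nat s / of_nat r)"
      using r s by (auto simp: field_simps add_eq_0_iff)
    finally show ?thesis using rho2 by (auto simp: power_mult_distrib)
  qed
  then have "poly F z = 0 \<longleftrightarrow> z = corner 0 \<or> z = corner 2 \<or> z = corner 1 \<or> z = corner 3" for z
    unfolding power2_eq_iff by (simp add: corner_def power2_eq_square power3_eq_cube mult.commute)
  moreover have "{..<4} = {0, 1, 2, 3::nat}" by auto
  ultimately show ?thesis by auto
qed

lemma inj_corner: "inj_on corner {..<4}"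
proof -
  have "{..<4} = {0, 1, 2, 3::nat}" by auto
  then show ?thesis using rho(1)
    by (simp add: corner_def power2_eq_square power3_eq_cube complex_eq_iff)
qed

text \<open>On both axes \<open>z^2\<close> is real, and \<open>F\<close> becomes the product of
  \<open>one_minus_power_mult_less_one\<close>: with \<open>y = t^2\<close> on the real axis, and
  with \<open>r\<close> and \<open>s\<close> exchanged on the imaginary one.\<close>

lemma cross_poly_spoke:
  assumes t: "0 < t" "t < norm (corner i)"
  shows "of_real t * \<i> ^ i \<in> preimage_01 F"
proof -
  have sq: "(of_real t * \<i> ^ i)\<^sup>2 = (if even i then of_real (t\<^sup>2) else - complex_of_real (t\<^sup>2))"
  proof -
    have "(of_real t * \<i> ^ i)\<^sup>2 = of_real (t\<^sup>2) * (\<i>\<^sup>2) ^ i"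
      by (simp add: power_mult_distrib flip: power_mult)
    then show ?thesis by simp
  qed
  have n: "norm (corner i) = (if even i then 1 else \<rho>)"
    using rho by (simp add: corner_def norm_mult norm_power)
  show ?thesis
  proof (cases "even i")
    case True
    define y where "y = t\<^sup>2"
    have y: "0 < y" "y < 1" using t True n by (auto simp: y_def power_less_one_iff)
    have "poly F (of_real t * \<i> ^ i) = of_real ((1 - y) ^ r * (1 + real r / real s * y) ^ s)"
      unfolding poly_cross_poly sq using True by (simp add: y_def)
    then show ?thesis using one_minus_power_mult_less_one[OF y r s]
      by (simp add: preimage_01_def open_segment_01 del: of_real_mult)
  next
    case False
    \<comment> \<open>This is the square of \<open>t / \<rho>\<close>, so the open spoke corresponds
      to \<open>y\<close> between 0 and 1.\<close>
    define y where "y = t\<^sup>2 * (real r / real s)"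
    have "t\<^sup>2 < \<rho>\<^sup>2" using t False n by (intro power_strict_mono) auto
    then have y: "0 < y" "y < 1" using t r s rho by (auto simp: y_def field_simps)
    have y': "t\<^sup>2 = real s / real r * y" using r s by (simp add: y_def)
    have "poly F (of_real t * \<i> ^ i) = of_real ((1 - y) ^ s * (1 + real s / real r * y) ^ r)"
      unfolding poly_cross_poly sq y' using False r s by (simp add: mult.commute)
    then show ?thesis using one_minus_power_mult_less_one[OF y s r]
      by (simp add: preimage_01_def open_segment_01 del: of_real_mult)
  qed
qed

text \<open>The four straight spokes from 0 lie in edges that end at the four roots. Their tangents
  are the powers of \<open>\<i>\<close>, which gives the cyclic order, and the multiplicities at the
  roots alternate between \<open>r\<close> and \<open>s\<close>.\<close>

lemma cross_poly_tree:
  obtains e where "centered (shabat_tree 0 1 F) 0" "e \<in> edges_at (shabat_tree 0 1 F) 0"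
    "black_degrees_around (shabat_tree 0 1 F) 0 e = [r, s, r, s]"
proof -
  let ?S = "shabat_tree 0 1 F"
  note F = shabat_cross_poly
  have S: "plane_graph ?S" by (rule plane_graph_shabat_tree[OF F])
  have w: "0 \<in> white ?S" "0 \<in> verts ?S" by (auto simp: verts_def shabat_tree_simps poly_cross_poly)
  have deg: "vdegree ?S 0 = 4"
    using vdegree_shabat_tree(2)[OF F, of 0] order_cross_poly(3) by (simp add: poly_cross_poly)
  have "\<exists>e. e \<in> edges_at ?S 0 \<and> corner i \<in> closure e \<and> tangent_direction 0 e = \<i> ^ i" for i
  proof (rule segment_in_edge[OF F w(2), of "\<i> ^ i" "norm (corner i)"])
    have n: "norm (corner i) = (if even i then 1 else \<rho>)"
      using rho by (simp add: corner_def norm_mult norm_power)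
    show "norm (\<i> ^ i) = 1" by (simp add: norm_power)
    show "0 < norm (corner i)" using n rho by simp
    show "0 + of_real t * \<i> ^ i \<in> preimage_01 F" if "0 < t" "t < norm (corner i)" for t
      using cross_poly_spoke that by simp
    fix e assume *: "e \<in> components (preimage_01 F)" "0 \<in> closure e"
      "0 + of_real (norm (corner i)) * \<i> ^ i \<in> closure e" "tangent_direction 0 e = \<i> ^ i"
    have "0 + of_real (norm (corner i)) * \<i> ^ i = corner i" using n by (simp add: corner_def)
    with * show ?thesis by (auto simp: shabat_tree_simps)
  qed
  then obtain e where e: "\<And>i. e i \<in> edges_at ?S 0" "\<And>i. corner i \<in> closure (e i)"
      "\<And>i. tangent_direction 0 (e i) = \<i> ^ i" by metis
  have eE: "e i \<in> edges ?S" for i using e(1) by (auto simp: edges_at_def)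
  have corner: "corner i \<in> black ?S" if "i < 4" for i
    using roots_cross_poly that by (auto simp: shabat_tree_simps)
  have be: "black_end ?S (e i) = corner i" if "i < 4" for i
    using inc_black_iff[OF S eE[of i] corner[OF that]] e(2)[of i] by (simp add: shabat_tree_simps(4))
  have inj: "inj_on e {..<4}"
    using be inj_corner by (intro inj_onI) (metis inj_onD lessThan_iff)
  \<comment> \<open>The four edges are distinct because their black ends are, and the vertex at 0
    has degree 4, so there are no others.\<close>
  have "e ` {..<4} = edges_at ?S 0"
  proof (rule card_subset_eq)
    show "finite (edges_at ?S 0)" using plane_graphD(4)[OF S w(2)] .
    show "card (e ` {..<4}) = card (edges_at ?S 0)"
      using card_image[OF inj] deg by (simp add: vdegree_def)
  qed (use e(1) in auto)
  note edges0 = this[symmetric]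
  have "centered ?S 0"
    unfolding centered_def
  proof (intro conjI ballI)
    show "inj_on (black_end ?S) (edges_at ?S 0)"
      unfolding edges0 using be inj_corner by (auto simp: inj_on_def)
    have "black_end ?S ` edges_at ?S 0 = corner ` {..<4}"
      unfolding edges0 image_image using be by (intro image_cong) auto
    then show "black_end ?S ` edges_at ?S 0 = black ?S" by (simp add: shabat_tree_simps roots_cross_poly)
    fix u assume "u \<in> white ?S - {0}"
    then show "vdegree ?S u = 1"
      using vdegree_shabat_tree(2)[OF F] order_cross_poly(4) by (simp add: shabat_tree_simps)
  qed (use S w in auto)
  moreover have rot: "rot ?S 0 (e i) = e (Suc i)" for i
  proof (rule rot_shabat_tree_eqI[OF F w(2) e(1) e(1)])
    \<comment> \<open>One spacing at a vertex of degree 4 is a quarter turn, which is multiplication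
      by \<open>\<i>\<close>.\<close>
    have "cis (2 * pi / 4) = \<i>" by (simp add: complex_eq_iff)
    then show "tangent_direction 0 (e (Suc i)) =
        tangent_direction 0 (e i) * cis (2 * pi / real (vdegree ?S 0))"
      by (simp add: e(3) deg mult.commute)
  qed
  have pow: "(rot ?S 0 ^^ i) (e 0) = e i" for i by (induction i) (simp_all add: rot)
  have cdeg: "vdegree ?S (corner i) = (if even i then r else s)" if "i < 4" for i
    using vdegree_shabat_tree(1)[OF F, of "corner i"] corner[OF that] order_cross_poly(1,2)[of "corner i"]
      corner_sq[of i] by (simp add: shabat_tree_simps split: if_splits)
  have "black_degrees_around ?S 0 (e 0) = [r, s, r, s]"
    by (simp add: black_degrees_around_def deg pow be cdeg upt_rec)
  ultimately show thesis using that e(1) by blast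
qed

end

theorem lemma4p2:
  fixes r s n :: nat
    and T :: "('v, 'e) bicolored_plane_graph"
    and w :: 'v and e :: 'e
    and R Q P :: "complex poly"
  assumes "0 < r" and "0 < s" and "r \<noteq> s" and "n = 2 * r + 2 * s"
    and "bicolored_plane_tree T"
    and "passport T = (replicate_mset 2 r + replicate_mset 2 s,
                       {#4#} + replicate_mset (n - 4) 1,
                       n)"
    and "w \<in> white T" and "vdegree T w = 4" and "e \<in> edges_at T w"
    and "black_degrees_around T w e = [r, s, r, s]"
    and "R = smult ((-1) ^ r * (of_nat r / of_nat s) ^ s)
               ([:-1, 1:] ^ r * [:of_nat s / of_nat r, 1:] ^ s)"
    and "Q = monom 1 2"
    and "P = pcompose R Q"
  shows "shabat_polynomial_of 0 1 P T"
proof -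
  have P: "P = cross_poly r s"
    using cross_poly_eq_pcompose[OF assms(1,2)] assms(11-13) by simp
  have fin: "finite (white T)"
    using assms(5) by (simp add: bicolored_plane_tree_def verts_def)
  have T: "centered T w"
  proof (rule centered_tree[OF assms(5,7)])
    \<comment> \<open>The black part of the passport has four entries, so there are as many black
      vertices as edges at \<open>w\<close>, as \<open>centered_tree\<close> requires.\<close>
    have "size (image_mset (vdegree T) (mset_set (black T))) = 4"
      using assms(6) by (simp add: passport_def)
    then show "card (black T) = vdegree T w" using assms(8) by simp
    show "vdegree T u = 1" if "u \<in> white T" "u \<noteq> w" for u
      by (rule image_mset_eq_1[where W = "white T" and w = w and d = 4 and m = "n - 4"])
        (use assms(6-8) fin that in \<open>simp_all add: passport_def\<close>)
  qed (use assms(9) in blast)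
  obtain f where f: "centered (shabat_tree 0 1 P) 0" "f \<in> edges_at (shabat_tree 0 1 P) 0"
      "black_degrees_around (shabat_tree 0 1 P) 0 f = [r, s, r, s]"
    unfolding P by (rule cross_poly_tree[OF assms(1,2)])
  have "plane_graph_iso (shabat_tree 0 1 P) T"
    by (rule centered_iso[OF f(1,2) T assms(9)]) (simp add: f(3) assms(10))
  moreover have "shabat_polynomial 0 1 P" unfolding P by (rule shabat_cross_poly[OF assms(1,2)])
  ultimately show ?thesis by (simp add: shabat_polynomial_of_def)
qed

end
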